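(* Let $V$ be a connected braided vector space of diagonal type of finite Cartan type with Cartan matrix $(a_{ij})_{n\times n}$ and braiding matrix $(q_{ij})$, and assume $q_{ij}=q_{ji}$ for $1\le i,j\le n$. Let $q\in F$, $q\neq 1$, and put $N=\mathrm{ord}(q_{11})$, $N_k=\mathrm{ord}(q_{kk})$ if $q_{kk}\ne1$ and $N_k=\infty$ if $q_{kk}=1$. In each item below $q_{ij}q_{ji}=1$ for pairs $i\neq j$ that are not listed as joined by an edge. (If a lower bound is infinite, it means $\dim\mathfrak L^-(V)=\infty$.) (i) Type $A_n$, $n>1$: $q_{ii}=q$ for all $i$, and $q_{i,i+1}q_{i+1,i}=q^{-1}$ for $1\le i<n$. If $q^2=1$, then $\dim\mathfrak L^-(V)\ge\binom n2+n$. If $q^2\ne1$, then $\dim\mathfrak L^-(V)\ge 2(n-1)(N-2)+3\binom n2-n+2$. (ii) Type $B_n$, $n>2$: $q_{ii}=q^2$ for $1\le i\le n-1$, $q_{nn}=q$, $q_{i,i+1}q_{i+1,i}=q^{-2}$ for $1\le i<n$. If $q^4=1$ and $q^2\neq1$, then $\dim\mathfrak L^-(V)\ge N_n-2+\binom n2+n$. If $q^4\neq1$, then $\dim\mathfrak L^-(V)\ge\sum_{k=1}^{n-1}(N_k-2)+\sum_{k=2}^{n}(N_k-2)+3\binom n2-2(n-1)+n$. (iii) Type $C_n$, $n>2$: $q_{ii}=q$ for $1\le i\le n-1$, $q_{nn}=q^2$, $q_{i,i+1}q_{i+1,i}=q^{-1}$ for $1\le i\le n-2$, $q_{n-1,n}q_{n,n-1}=q^{-2}$.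 If $q^4=1$ and $q^2\ne1$, then $\dim\mathfrak L^-(V)\ge\sum_{k=1}^{n-2}(N_k-2)+\sum_{k=2}^{n-1}(N_k-2)+3\binom{n-1}2-2(n-2)+(n-1)+\bigl(N_{n-1}-2+(n-1)+(n-2)+1\bigr)$. If $q^4\neq1$, then $\dim\mathfrak L^-(V)\ge\sum_{k=1}^{n-1}(N_k-2)+\sum_{k=2}^{n}(N_k-2)+3\binom n2-2(n-1)+n$. (iv) Type $D_n$, $n>3$: $q_{ii}=q$ for all $i$; edges $\{i,i+1\}$ for $1\le i\le n-2$ and $\{n-2,n\}$, with $q_{ij}q_{ji}=q^{-1}$ on edges. If $q^2=1$, then $\dim\mathfrak L^-(V)\ge\binom{n-1}2+2n-1$. If $q^2\neq1$, then $\dim\mathfrak L^-(V)\ge2(n-2)(N-2)+3\binom{n-1}2+2n+2N-5$. (v) Type $E_8$: $q_{ii}=q$ for all $i$; edges $\{i,i+1\}$ for $1\le i\le6$ and $\{5,8\}$, with $q_{ij}q_{ji}=q^{-1}$ on edges. If $q^2=1$, then $\dim\mathfrak L^-(V)\ge\binom72+15$. If $q^2\ne1$, then $\dim\mathfrak L^-(V)\ge14N+50$. (vi) Type $E_7$ ($q_{ii}=q$ for all $i$, $q_{ij}q_{ji}=q^{-1}$ on edges of the Dynkin diagram $E_7$). If $q^2=1$, then $\dim\mathfrak L^-(V)\ge\binom62+13$. If $q^2\neq1$, then $\dim\mathfrak L^-(V)\ge12N+34$. (vii) Type $E_6$ ($q_{ii}=q$ for all $i$, $q_{ij}q_{ji}=q^{-1}$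 on edges of the Dynkin diagram $E_6$). If $q^2=1$, then $\dim\mathfrak L^-(V)\ge\binom52+6+5$. If $q^2\neq1$, then $\dim\mathfrak L^-(V)\ge10N+21$. (viii) Type $F_4$: $q_{11}=q_{22}=q^2$, $q_{33}=q_{44}=q$, $q_{12}q_{21}=q_{23}q_{32}=q^{-2}$, $q_{34}q_{43}=q^{-1}$. If $q^4=1$ and $q^2\neq1$, then $\dim\mathfrak L^-(V)\ge2(N_3-2)+(N_4-2)+\binom42+4+4$. If $q^4\neq1$, then $\dim\mathfrak L^-(V)\ge\sum_{k=1}^{3}(N_k-2)+\sum_{k=2}^{4}(N_k-2)+3\binom42-2\cdot3+4$. (ix) Type $G_2$: $q_{11}=q$, $q_{22}=q^3$, $q_{12}q_{21}=q^{-3}$. If $q^2=1$, then $\dim\mathfrak L^-(V)\ge3$. If $q^2\neq1$, then $\dim\mathfrak L^-(V)\ge(N_1-2)+(N_2-2)+3$.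
   Context: $F$ is a field of characteristic zero. $V$ is a vector space over $F$ with basis $x_1,\dots,x_n$ ($n>1$), with braiding of diagonal type $C(x_i\otimes x_j)=q_{ij}\,x_j\otimes x_i$, $q_{ij}\in F\setminus\{0\}$. $V$ is connected if the graph on $\{1,\dots,n\}$ with an edge between $i\neq j$ exactly when $q_{ij}q_{ji}\neq1$ is connected. $V$ is of finite Cartan type with Cartan matrix $(a_{ij})$ if $(a_{ij})$ is a Cartan matrix of finite type and $q_{ij}q_{ji}=q_{ii}^{a_{ij}}$ for all $i\neq j$. $\mathfrak B(V)$ is the Nichols algebra of $(V,C)$, i.e. the quotient of the tensor algebra $T(V)$ by the sum of the kernels of the quantum symmetrizers. $\mathfrak L^-(V)$ (the Nichols Lie algebra) is the Lie subalgebra generated by $V$ in $\mathfrak B(V)$ equipped with the commutator $[a,b]^-=ab-ba$. $\mathrm{ord}(\cdot)$ is the multiplicative order, possibly $\infty$. *)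

theory Defs
  imports "HOL-Algebra.Embedded_Algebras" "HOL-Algebra.QuotRing" "HOL-Library.Poly_Mapping" "HOL-Library.Extended_Real"
begin

text \<open>
  The word \<open>Word [i\<^sub>1, \<dots>, i\<^sub>m]\<close> stands for \<open>x\<^bsub>i\<^sub>1\<^esub> \<otimes> \<cdots> \<otimes> x\<^bsub>i\<^sub>m\<^esub>\<close>. With concatenation as (noncommutative)
  addition of words, the convolution product of \<open>HOL-Library.Poly_Mapping\<close> on finitely supported
  functions \<open>word \<Rightarrow>\<^sub>0 'a\<close> is the product of the free associative algebra, i.e. of \<open>T(V)\<close>.
\<close>

datatype word = Word (letters: "nat list")

instantiation word :: monoid_add
begin

definition zero_word :: word where
  "zero_word = Word []"

definition plus_word :: "word \<Rightarrow> word \<Rightarrow> word" where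
  "plus_word u v = Word (letters u @ letters v)"

instance
  by standard (simp_all add: zero_word_def plus_word_def)

end

definition tensor_algebra :: "nat \<Rightarrow> (word \<Rightarrow>\<^sub>0 'a::field) ring" where
  "tensor_algebra n =
    \<lparr>carrier = {p. \<forall>w \<in> Poly_Mapping.keys p. set (letters w) \<subseteq> {1..n}},
     monoid.mult = (*), one = 1, zero = 0, add = (+)\<rparr>"

definition tensor_power :: "nat \<Rightarrow> nat \<Rightarrow> (word \<Rightarrow>\<^sub>0 'a::field) set" where
  "tensor_power n m =
    {p \<in> carrier (tensor_algebra n). \<forall>w \<in> Poly_Mapping.keys p. length (letters w) = m}"


text \<open>
  \<open>braid_at Q i\<close> is \<open>id\<^bsup>\<otimes>i\<^esup> \<otimes> C \<otimes> id\<^bsup>\<otimes>(m-i-2)\<^esup>\<close> on \<open>V\<^bsup>\<otimes>m\<^esup>\<close> for \<open>C (x\<^sub>a \<otimes> x\<^sub>b) = Q a b \<cdot> x\<^sub>b \<otimes> x\<^sub>a\<close>;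
  tensor positions are counted from 0, and the operator is only used for \<open>i + 1 < m\<close>.
\<close>

definition swap_letters :: "nat \<Rightarrow> word \<Rightarrow> word" where
  "swap_letters i w = Word ((letters w)[i := letters w ! Suc i, Suc i := letters w ! i])"

definition braid_at ::
  "(nat \<Rightarrow> nat \<Rightarrow> 'a::field) \<Rightarrow> nat \<Rightarrow> (word \<Rightarrow>\<^sub>0 'a) \<Rightarrow> (word \<Rightarrow>\<^sub>0 'a)" where
  "braid_at Q i p =
    (\<Sum>w \<in> Poly_Mapping.keys p.
      Poly_Mapping.single (swap_letters i w)
        (Poly_Mapping.lookup p w * Q (letters w ! i) (letters w ! Suc i)))"

text \<open>
  Write \<open>C\<^sub>i\<close> for \<open>braid_at Q i\<close>. Then \<open>braid_chain Q k l = C\<^sub>k C\<^bsub>k+1\<^esub> \<cdots> C\<^bsub>k+l-1\<^esub>\<close> (the rightmost factor acts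
  first), and \<open>braid_sum Q k j = \<Sum>l\<le>j. C\<^sub>k \<cdots> C\<^bsub>k+l-1\<^esub>\<close> is \<open>id\<^bsup>\<otimes>k\<^esup> \<otimes> S\<^bsub>1,j\<^esub>\<close> with
  \<open>S\<^bsub>1,j\<^esub> = id + C\<^sub>0 + C\<^sub>0 C\<^sub>1 + \<cdots> + C\<^sub>0 C\<^sub>1 \<cdots> C\<^bsub>j-1\<^esub>\<close>.
  The quantum symmetrizer of \<open>V\<^bsup>\<otimes>m\<^esup>\<close> is
  \<open>S\<^sub>m = (id\<^bsup>\<otimes>(m-2)\<^esup> \<otimes> S\<^bsub>1,1\<^esub>) (id\<^bsup>\<otimes>(m-3)\<^esup> \<otimes> S\<^bsub>1,2\<^esub>) \<cdots> (id \<otimes> S\<^bsub>1,m-2\<^esub>) S\<^bsub>1,m-1\<^esub>\<close>,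
  which is the sum over the symmetric group on \<open>m\<close> letters of the operators obtained from reduced
  expressions by replacing each simple transposition by the corresponding \<open>C\<^sub>i\<close>. Here
  \<open>symmetrizer_prod Q m j\<close> is the product of the leftmost \<open>j\<close> factors.
\<close>

primrec braid_chain ::
  "(nat \<Rightarrow> nat \<Rightarrow> 'a::field) \<Rightarrow> nat \<Rightarrow> nat \<Rightarrow> (word \<Rightarrow>\<^sub>0 'a) \<Rightarrow> (word \<Rightarrow>\<^sub>0 'a)" where
  "braid_chain Q k 0 p = p"
| "braid_chain Q k (Suc l) p = braid_chain Q k l (braid_at Q (k + l) p)"

definition braid_sum ::
  "(nat \<Rightarrow> nat \<Rightarrow> 'a::field) \<Rightarrow> nat \<Rightarrow> nat \<Rightarrow> (word \<Rightarrow>\<^sub>0 'a) \<Rightarrow> (word \<Rightarrow>\<^sub>0 'a)" where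
  "braid_sum Q k j p = (\<Sum>l\<le>j. braid_chain Q k l p)"

primrec symmetrizer_prod ::
  "(nat \<Rightarrow> nat \<Rightarrow> 'a::field) \<Rightarrow> nat \<Rightarrow> nat \<Rightarrow> (word \<Rightarrow>\<^sub>0 'a) \<Rightarrow> (word \<Rightarrow>\<^sub>0 'a)" where
  "symmetrizer_prod Q m 0 p = p"
| "symmetrizer_prod Q m (Suc j) p =
    symmetrizer_prod Q m j (braid_sum Q (m - Suc (Suc j)) (Suc j) p)"

definition quantum_symmetrizer ::
  "(nat \<Rightarrow> nat \<Rightarrow> 'a::field) \<Rightarrow> nat \<Rightarrow> (word \<Rightarrow>\<^sub>0 'a) \<Rightarrow> (word \<Rightarrow>\<^sub>0 'a)" where
  "quantum_symmetrizer Q m = symmetrizer_prod Q m (m - 1)"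

definition symmetrizer_kernel ::
  "nat \<Rightarrow> (nat \<Rightarrow> nat \<Rightarrow> 'a::field) \<Rightarrow> nat \<Rightarrow> (word \<Rightarrow>\<^sub>0 'a) set" where
  "symmetrizer_kernel n Q m = {p \<in> tensor_power n m. quantum_symmetrizer Q m p = 0}"

definition nichols_ideal ::
  "nat \<Rightarrow> (nat \<Rightarrow> nat \<Rightarrow> 'a::field) \<Rightarrow> (word \<Rightarrow>\<^sub>0 'a) set" where
  "nichols_ideal n Q = {\<Sum>m<k. f m | f k. \<forall>m. f m \<in> symmetrizer_kernel n Q m}"

definition nichols_algebra ::
  "nat \<Rightarrow> (nat \<Rightarrow> nat \<Rightarrow> 'a::field) \<Rightarrow> (word \<Rightarrow>\<^sub>0 'a) set ring" where
  "nichols_algebra n Q = tensor_algebra n Quot nichols_ideal n Q"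

definition nichols_class ::
  "nat \<Rightarrow> (nat \<Rightarrow> nat \<Rightarrow> 'a::field) \<Rightarrow> (word \<Rightarrow>\<^sub>0 'a) \<Rightarrow> (word \<Rightarrow>\<^sub>0 'a) set" where
  "nichols_class n Q p = nichols_ideal n Q +>\<^bsub>tensor_algebra n\<^esub> p"

text \<open>The copy \<open>F \<cdot> 1\<close> of the ground field inside the Nichols algebra.\<close>

definition nichols_scalars ::
  "nat \<Rightarrow> (nat \<Rightarrow> nat \<Rightarrow> 'a::field) \<Rightarrow> (word \<Rightarrow>\<^sub>0 'a) set set" where
  "nichols_scalars n Q = range (\<lambda>c. nichols_class n Q (Poly_Mapping.single 0 c))"


text \<open>
  The Lie subalgebra generated by \<open>X\<close> in the \<open>K\<close>-algebra \<open>R\<close> with the commutator bracket, where the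
  subfield \<open>K\<close> of \<open>R\<close> acts by multiplication.
\<close>

inductive_set commutator_lie_span :: "('b, 'c) ring_scheme \<Rightarrow> 'b set \<Rightarrow> 'b set \<Rightarrow> 'b set"
  for R (structure) and K X where
  generator: "x \<in> X \<Longrightarrow> x \<in> commutator_lie_span R K X"
| zero: "\<zero> \<in> commutator_lie_span R K X"
| add: "\<lbrakk>x \<in> commutator_lie_span R K X; y \<in> commutator_lie_span R K X\<rbrakk>
    \<Longrightarrow> x \<oplus> y \<in> commutator_lie_span R K X"
| scale: "\<lbrakk>k \<in> K; x \<in> commutator_lie_span R K X\<rbrakk>
    \<Longrightarrow> k \<otimes> x \<in> commutator_lie_span R K X"
| bracket: "\<lbrakk>x \<in> commutator_lie_span R K X; y \<in> commutator_lie_span R K X\<rbrakk>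
    \<Longrightarrow> (x \<otimes> y) \<ominus> (y \<otimes> x) \<in> commutator_lie_span R K X"

definition nichols_lie ::
  "nat \<Rightarrow> (nat \<Rightarrow> nat \<Rightarrow> 'a::field) \<Rightarrow> (word \<Rightarrow>\<^sub>0 'a) set set" where
  "nichols_lie n Q =
    commutator_lie_span (nichols_algebra n Q) (nichols_scalars n Q)
      (nichols_class n Q ` tensor_power n 1)"

text \<open>\<open>ring.dim\<close> is only meaningful in finite dimension, hence the case distinction.\<close>

definition ext_dim :: "('b, 'c) ring_scheme \<Rightarrow> 'b set \<Rightarrow> 'b set \<Rightarrow> ereal" where
  "ext_dim R K E =
    (if ring.finite_dimension R K E then ereal (real (ring.dim R K E)) else \<infinity>)"

definition nichols_lie_dim :: "nat \<Rightarrow> (nat \<Rightarrow> nat \<Rightarrow> 'a::field) \<Rightarrow> ereal" where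
  "nichols_lie_dim n Q =
    ext_dim (nichols_algebra n Q) (nichols_scalars n Q) (nichols_lie n Q)"


definition mult_order :: "'a::field \<Rightarrow> ereal" where
  "mult_order x =
    (if \<exists>k>0. x ^ k = 1 then ereal (real (LEAST k. k > 0 \<and> x ^ k = 1)) else \<infinity>)"

definition diag_order :: "(nat \<Rightarrow> nat \<Rightarrow> 'a::field) \<Rightarrow> nat \<Rightarrow> ereal" where
  "diag_order Q k = (if Q k k = 1 then \<infinity> else mult_order (Q k k))"

definition connected_braiding :: "nat \<Rightarrow> (nat \<Rightarrow> nat \<Rightarrow> 'a::field) \<Rightarrow> bool" where
  "connected_braiding n Q \<longleftrightarrow>
    (\<forall>i\<in>{1..n}. \<forall>j\<in>{1..n}.
      (i, j) \<in> {(k, l). k \<in> {1..n} \<and> l \<in> {1..n} \<and> k \<noteq> l \<and> Q k l * Q l k \<noteq> 1}\<^sup>*)"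

text \<open>\<open>E\<close> is a set of two-element sets of vertices.\<close>

definition unlinked_outside ::
  "nat \<Rightarrow> (nat \<Rightarrow> nat \<Rightarrow> 'a::field) \<Rightarrow> nat set set \<Rightarrow> bool" where
  "unlinked_outside n Q E \<longleftrightarrow>
    (\<forall>i\<in>{1..n}. \<forall>j\<in>{1..n}. i \<noteq> j \<and> {i, j} \<notin> E \<longrightarrow> Q i j * Q j i = 1)"

text \<open>
  Cartan matrices of finite type: generalized Cartan matrices that become symmetric and positive
  definite after scaling the rows by positive numbers.
\<close>

definition finite_cartan_matrix :: "nat \<Rightarrow> (nat \<Rightarrow> nat \<Rightarrow> int) \<Rightarrow> bool" where
  "finite_cartan_matrix n a \<longleftrightarrow>
    (\<forall>i\<in>{1..n}. a i i = 2) \<and>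
    (\<forall>i\<in>{1..n}. \<forall>j\<in>{1..n}. i \<noteq> j \<longrightarrow> a i j \<le> 0 \<and> (a i j = 0 \<longleftrightarrow> a j i = 0)) \<and>
    (\<exists>d :: nat \<Rightarrow> real.
      (\<forall>i\<in>{1..n}. d i > 0) \<and>
      (\<forall>i\<in>{1..n}. \<forall>j\<in>{1..n}. d i * of_int (a i j) = d j * of_int (a j i)) \<and>
      (\<forall>x :: nat \<Rightarrow> real. (\<exists>i\<in>{1..n}. x i \<noteq> 0) \<longrightarrow>
        (\<Sum>i\<in>{1..n}. \<Sum>j\<in>{1..n}. d i * of_int (a i j) * x i * x j) > 0))"

definition finite_cartan_type ::
  "nat \<Rightarrow> (nat \<Rightarrow> nat \<Rightarrow> 'a::field) \<Rightarrow> (nat \<Rightarrow> nat \<Rightarrow> int) \<Rightarrow> bool" where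
  "finite_cartan_type n Q a \<longleftrightarrow>
    finite_cartan_matrix n a \<and>
    (\<forall>i\<in>{1..n}. \<forall>j\<in>{1..n}. i \<noteq> j \<longrightarrow> Q i j * Q j i = Q i i powi a i j)"

text \<open>
  Dynkin diagrams with a fixed numbering. \<open>E\<^sub>n\<close> is the chain \<open>1, \<dots>, n-1\<close> with the vertex \<open>n\<close> attached
  to \<open>n-3\<close>. The orientation of the multiple edges is forced by \<open>q\<^bsub>ij\<^esub> q\<^bsub>ji\<^esub> = q\<^bsub>ii\<^esub>\<^bsup>a\<^esup>\<close> with \<open>a = a\<^bsub>ij\<^esub>\<close>, the
  short simple roots being those with the smaller power of \<open>q\<close> on the diagonal.
\<close>

definition chain_edges :: "nat \<Rightarrow> nat set set" where
  "chain_edges n = {{i, i + 1} | i. 1 \<le> i \<and> i < n}"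

definition D_edges :: "nat \<Rightarrow> nat set set" where
  "D_edges n = insert {n - 2, n} (chain_edges (n - 1))"

definition E_edges :: "nat \<Rightarrow> nat set set" where
  "E_edges n = insert {n - 3, n} (chain_edges (n - 1))"

definition simply_laced :: "nat set set \<Rightarrow> nat \<Rightarrow> nat \<Rightarrow> int" where
  "simply_laced E i j = (if i = j then 2 else if {i, j} \<in> E then - 1 else 0)"

datatype dynkin = Type_A | Type_B | Type_C | Type_D | Type_E | Type_F4 | Type_G2

primrec dynkin_matrix :: "dynkin \<Rightarrow> nat \<Rightarrow> nat \<Rightarrow> nat \<Rightarrow> int" where
  "dynkin_matrix Type_A n = simply_laced (chain_edges n)"
| "dynkin_matrix Type_B n =
    (\<lambda>i j. if (i, j) = (n, n - 1) then - 2 else simply_laced (chain_edges n) i j)"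
| "dynkin_matrix Type_C n =
    (\<lambda>i j. if (i, j) = (n - 1, n) then - 2 else simply_laced (chain_edges n) i j)"
| "dynkin_matrix Type_D n = simply_laced (D_edges n)"
| "dynkin_matrix Type_E n = simply_laced (E_edges n)"
| "dynkin_matrix Type_F4 n =
    (\<lambda>i j. if (i, j) = (3, 2) then - 2 else simply_laced (chain_edges 4) i j)"
| "dynkin_matrix Type_G2 n =
    (\<lambda>i j. if (i, j) = (1, 2) then - 3 else simply_laced (chain_edges 2) i j)"

definition has_dynkin_type :: "dynkin \<Rightarrow> nat \<Rightarrow> (nat \<Rightarrow> nat \<Rightarrow> int) \<Rightarrow> bool" where
  "has_dynkin_type X n a \<longleftrightarrow> (\<forall>i\<in>{1..n}. \<forall>j\<in>{1..n}. a i j = dynkin_matrix X n i j)"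

end

theory Submission
  imports Defs "HOL-Library.Multiset"
begin

text \<open>
  Let \<open>D\<^sub>i\<close> be the skew derivation of \<open>T(V)\<close> with \<open>D\<^sub>i x\<^sub>j = \<delta>\<^bsub>ij\<^esub>\<close> and
  \<open>D\<^sub>i (x\<^sub>j p) = \<delta>\<^bsub>ij\<^esub> p + q\<^bsub>ji\<^esub> x\<^sub>j D\<^sub>i p\<close>. Since \<open>S\<^bsub>m+1\<^esub> p = (\<Sum>i. x\<^sub>i S\<^sub>m (D\<^sub>i p))\<close>, the kernel of the
  quantum symmetrizer consists of the tensors killed by all iterated skew derivations of full length.
  If \<open>p\<close> does not involve \<open>x\<^sub>i\<close> and an iterated skew derivation of multidegree \<open>\<beta>\<close> maps \<open>p\<close> to the
  scalar \<open>c\<close>, then it maps \<open>(ad x\<^sub>i)\<^sup>k p\<close> to \<open>c (\<chi> - 1)\<^sup>k x\<^sub>i\<^sup>k\<close>, where \<open>\<chi> = (\<Prod>j\<in>\<beta>. q\<^bsub>ij\<^esub>)\<close>; and \<open>x\<^sub>i\<^sup>k\<close> is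
  nonzero in the Nichols algebra for \<open>k < N\<^sub>i\<close>. By symmetry \<open>\<chi>\<^sup>2 = (\<Prod>j\<in>\<beta>. q\<^bsub>ij\<^esub> q\<^bsub>ji\<^esub>)\<close>, which differs from
  \<open>1\<close> when exactly one letter of \<open>\<beta>\<close> is adjacent to \<open>i\<close>.

  Hence for every induced path \<open>P\<close> from \<open>i\<close> to \<open>j\<close> the Nichols Lie algebra is nonzero in the
  multidegrees \<open>1\<^sub>P + k e\<^sub>i\<close> with \<open>k \<le> N\<^sub>i - 2\<close>. As \<open>P\<close> determines its end points, one path for each pair
  of vertices gives \<open>dim \<ge> n + (n choose 2) + (n - 1) (\<Sum>i. N\<^sub>i - 2)\<close> for every connected symmetric
  braiding, and this is at least each of the bounds in the theorem.
\<close>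

subsection \<open>Linear maps on the tensor algebra\<close>

text \<open>Writing scalars as multiples of the empty word makes the scalar action a case of the
  algebra product, so that linearity reduces to associativity and centrality.\<close>

abbreviation scal :: "'a::field \<Rightarrow> (word \<Rightarrow>\<^sub>0 'a)" where
  "scal c \<equiv> Poly_Mapping.single 0 c"

abbreviation gen :: "nat \<Rightarrow> (word \<Rightarrow>\<^sub>0 'a::field)" where
  "gen i \<equiv> Poly_Mapping.single (Word [i]) 1"

lemma gen_mult_single: "gen i * Poly_Mapping.single (Word w) c = Poly_Mapping.single (Word (i # w)) c"
  by (simp add: mult_single plus_word_def)

lemma scal_mult_single: "scal c * Poly_Mapping.single w d = Poly_Mapping.single w (c * d)"
  by (simp add: mult_single)

lemma scal_mult_scal: "scal c * scal d = scal (c * d)"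
  by (simp add: mult_single)

lemma poly_mapping_single_induct [case_names zero single add]:
  fixes p :: "'b \<Rightarrow>\<^sub>0 'a::comm_monoid_add"
  assumes zero: "P 0"
    and single: "\<And>w c. w \<in> Poly_Mapping.keys p \<Longrightarrow> P (Poly_Mapping.single w c)"
    and add: "\<And>q r. P q \<Longrightarrow> P r \<Longrightarrow> P (q + r)"
  shows "P p"
proof -
  have "P (\<Sum>w\<in>A. Poly_Mapping.single w (Poly_Mapping.lookup p w))"
    if "A \<subseteq> Poly_Mapping.keys p" for A
    using finite_subset[OF that finite_keys] that
    by (induction A rule: finite_induct) (auto intro: zero add single)
  moreover have "p = (\<Sum>w\<in>Poly_Mapping.keys p. Poly_Mapping.single w (Poly_Mapping.lookup p w))"
    by (rule poly_mapping_eqI)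
      (auto simp: lookup_sum lookup_single when_def in_keys_iff sum.delta)
  ultimately show ?thesis by (metis order_refl)
qed

text \<open>Words grow by letters put in front, the direction in which the skew derivations recurse.
  The set \<open>I\<close> keeps the induction inside the carrier of T(V).\<close>

lemma tensor_induct [consumes 1, case_names scal gen add]:
  fixes p :: "word \<Rightarrow>\<^sub>0 'a::field"
  assumes letters: "\<forall>w\<in>Poly_Mapping.keys p. set (letters w) \<subseteq> I"
    and scal: "\<And>c. P (scal c)"
    and gen: "\<And>i q. i \<in> I \<Longrightarrow> P q \<Longrightarrow> P (gen i * q)"
    and add: "\<And>q r. P q \<Longrightarrow> P r \<Longrightarrow> P (q + r)"
  shows "P p"
proof (induction p rule: poly_mapping_single_induct)
  case zero
  then show ?case using scal[of 0] by simp
next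
  case (single w c)
  have "P (Poly_Mapping.single (Word ws) c)" if "set ws \<subseteq> I" for ws
    using that
  proof (induction ws)
    case Nil
    then show ?case using scal[of c] by (simp add: zero_word_def)
  next
    case (Cons i ws)
    then show ?case using gen[of i "Poly_Mapping.single (Word ws) c"] by (simp add: gen_mult_single)
  qed
  then show ?case
    using letters single by (cases w) auto
qed (rule add)

lemma free_algebra_induct [case_names scal gen add]:
  fixes p :: "word \<Rightarrow>\<^sub>0 'a::field"
  assumes "\<And>c. P (scal c)" "\<And>i q. P q \<Longrightarrow> P (gen i * q)" "\<And>q r. P q \<Longrightarrow> P r \<Longrightarrow> P (q + r)"
  shows "P p"
  by (rule tensor_induct[where I = UNIV]) (use assms in auto)

lemma scal_mult_commute: "p * scal c = scal c * (p :: word \<Rightarrow>\<^sub>0 'a::field)"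
  by (induction p rule: poly_mapping_single_induct)
    (simp_all add: mult_single algebra_simps)

lemma lookup_gen_mult:
  "Poly_Mapping.lookup (gen i * p) (Word v) =
    (if v \<noteq> [] \<and> hd v = i then Poly_Mapping.lookup p (Word (tl v)) else 0)"
proof (induction p rule: poly_mapping_single_induct)
  case (single w c)
  then show ?case
    by (cases w; cases v) (auto simp: gen_mult_single lookup_single when_def)
qed (simp_all add: algebra_simps lookup_add)

lemma lookup_scal_mult: "Poly_Mapping.lookup (scal c * p) w = c * Poly_Mapping.lookup p w"
  by (induction p rule: poly_mapping_single_induct)
    (auto simp: mult_single lookup_single when_def lookup_add distrib_left)

definition lin_ext :: "(word \<Rightarrow> (word \<Rightarrow>\<^sub>0 'a::field)) \<Rightarrow> (word \<Rightarrow>\<^sub>0 'a) \<Rightarrow> (word \<Rightarrow>\<^sub>0 'a)" where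
  "lin_ext f p = (\<Sum>w\<in>Poly_Mapping.keys p. scal (Poly_Mapping.lookup p w) * f w)"

lemma lin_ext_zero [simp]: "lin_ext f 0 = 0"
  by (simp add: lin_ext_def)

lemma lin_ext_add: "lin_ext f (p + q) = lin_ext f p + lin_ext f q"
  unfolding lin_ext_def
  by (rule setsum_keys_plus_distrib) (simp_all add: single_add distrib_right)

lemma lin_ext_single: "lin_ext f (Poly_Mapping.single w c) = scal c * f w"
  by (simp add: lin_ext_def)

lemma lin_ext_scal_mult: "lin_ext f (scal c * p) = scal c * lin_ext f p"
proof (induction p rule: poly_mapping_single_induct)
  case (single w d)
  then show ?case
    by (simp add: lin_ext_single scal_mult_single mult.assoc[symmetric] scal_mult_scal)
qed (simp_all add: distrib_left lin_ext_add)

lemma keys_lin_ext: "Poly_Mapping.keys (lin_ext f p) \<subseteq> (\<Union>w\<in>Poly_Mapping.keys p. Poly_Mapping.keys (f w))"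
proof -
  have "Poly_Mapping.keys (scal c * q) \<subseteq> Poly_Mapping.keys q" for c and q :: "word \<Rightarrow>\<^sub>0 'a"
    using keys_mult[of "scal c" q] by (auto split: if_splits)
  then show ?thesis
    unfolding lin_ext_def using keys_sum by fastforce
qed

subsection \<open>Skew derivations\<close>

text \<open>In closed form, every occurrence of \<open>i\<close> contributes the word with that
  occurrence deleted, weighted by the factors \<open>Q j i\<close> of all letters \<open>j\<close>
  to its left.\<close>

fun skew_word :: "(nat \<Rightarrow> nat \<Rightarrow> 'a::field) \<Rightarrow> nat \<Rightarrow> nat list \<Rightarrow> (word \<Rightarrow>\<^sub>0 'a)" where
  "skew_word Q i [] = 0"
| "skew_word Q i (j # w) =
    (if j = i then Poly_Mapping.single (Word w) 1 else 0) + scal (Q j i) * (gen j * skew_word Q i w)"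

definition skew :: "(nat \<Rightarrow> nat \<Rightarrow> 'a::field) \<Rightarrow> nat \<Rightarrow> (word \<Rightarrow>\<^sub>0 'a) \<Rightarrow> (word \<Rightarrow>\<^sub>0 'a)" where
  "skew Q i = lin_ext (\<lambda>w. skew_word Q i (letters w))"

text \<open>This is the algebra endomorphism x_j |-> q_ji x_j, which enters the Leibniz rule D_i(p
  r) = D_i(p) r + twist(p) D_i(r).\<close>

definition twist :: "(nat \<Rightarrow> nat \<Rightarrow> 'a::field) \<Rightarrow> nat \<Rightarrow> (word \<Rightarrow>\<^sub>0 'a) \<Rightarrow> (word \<Rightarrow>\<^sub>0 'a)" where
  "twist Q i = lin_ext (\<lambda>w. Poly_Mapping.single w (\<Prod>j\<leftarrow>letters w. Q j i))"

lemma skew_zero [simp]: "skew Q i 0 = 0"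
  and skew_add: "skew Q i (p + q) = skew Q i p + skew Q i q"
  and skew_scal_mult: "skew Q i (scal c * p) = scal c * skew Q i p"
  by (simp_all add: skew_def lin_ext_add lin_ext_scal_mult)

lemma twist_zero [simp]: "twist Q i 0 = 0"
  and twist_add: "twist Q i (p + q) = twist Q i p + twist Q i q"
  and twist_scal_mult: "twist Q i (scal c * p) = scal c * twist Q i p"
  by (simp_all add: twist_def lin_ext_add lin_ext_scal_mult)

lemma skew_gen_mult:
  "skew Q i (gen j * p) = (if j = i then p else 0) + scal (Q j i) * (gen j * skew Q i p)"
proof (induction p rule: poly_mapping_single_induct)
  case (single w c)
  have "scal c * scal (Q j i) * gen j = scal (Q j i) * gen j * scal c"
    by (simp add: mult_single mult.commute)
  then show ?case
    by (cases w)
      (auto simp: gen_mult_single skew_def lin_ext_single distrib_left scal_mult_single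
        mult.assoc[symmetric])
qed (auto simp: skew_add algebra_simps)

lemma twist_gen_mult: "twist Q i (gen j * p) = scal (Q j i) * (gen j * twist Q i p)"
proof (induction p rule: poly_mapping_single_induct)
  case (single w c)
  then show ?case
    by (cases w) (simp add: gen_mult_single twist_def lin_ext_single mult_single algebra_simps plus_word_def zero_word_def)
qed (auto simp: twist_add algebra_simps)

lemma skew_scal [simp]: "skew Q i (scal c) = 0"
  by (simp add: skew_def lin_ext_single zero_word_def)

lemma twist_scal [simp]: "twist Q i (scal c) = scal c"
  by (simp add: twist_def lin_ext_single zero_word_def mult_single plus_word_def)

lemma gen_scal_left_commute: "gen j * (scal c * p) = scal c * (gen j * p)"
  by (metis mult.assoc scal_mult_commute)

lemma scal_left_commute: "scal d * (scal c * p) = scal c * (scal d * p)"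
  by (metis mult.assoc scal_mult_commute)

text \<open>The definition strips letters on the left. Commutators and the right ideal property need
  the Leibniz rule at the right end as well; induction on the left factor accumulates the
  twist.\<close>

lemma skew_mult_gen:
  "skew Q i (p * gen j) = skew Q i p * gen j + (if j = i then twist Q i p else 0)"
proof (induction p rule: free_algebra_induct)
  case (scal c)
  have "skew Q i 1 = 0"
    using skew_scal[of Q i 1] by simp
  then have "skew Q i (gen j) = (if j = i then 1 else 0)"
    using skew_gen_mult[of Q i j 1] by simp
  then show ?case
    by (simp add: skew_scal_mult)
next
  case (gen k q)
  then show ?case
    by (simp add: skew_gen_mult mult.assoc distrib_left distrib_right twist_gen_mult algebra_simps)
qed (auto simp: skew_add twist_add algebra_simps)

text \<open>\<open>twist\<close> scales a word by a product over its letters, and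
  \<open>skew Q k\<close> deletes one letter \<open>k\<close>, so exchanging the two operators costs
  the factor of that letter.\<close>

lemma skew_twist: "skew Q k (twist Q i p) = scal (Q k i) * twist Q i (skew Q k p)"
proof (induction p rule: free_algebra_induct)
  case (gen j q)
  then show ?case
    by (auto simp: twist_gen_mult skew_gen_mult skew_scal_mult twist_add twist_scal_mult
        distrib_left gen_scal_left_commute scal_left_commute)
qed (auto simp: skew_add twist_add algebra_simps)

text \<open>Multisets of letters encode multidegrees, and the derivation lowers the multidegree by
  e_i. This grading later separates the Lie elements.\<close>

lemma keys_skew:
  assumes "v \<in> Poly_Mapping.keys (skew Q i p)"
  shows "\<exists>u\<in>Poly_Mapping.keys p. mset (letters u) = add_mset i (mset (letters v))"
proof -
  have keys: "\<exists>a\<in>Poly_Mapping.keys q. \<exists>b\<in>Poly_Mapping.keys r. u = a + b"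
    if "u \<in> Poly_Mapping.keys (q * r)" for u and q r :: "word \<Rightarrow>\<^sub>0 'a"
    using that keys_mult[of q r] by blast
  have word: "mset w = add_mset i (mset (letters u))" if "u \<in> Poly_Mapping.keys (skew_word Q i w)" for w u
    using that
  proof (induction w arbitrary: u)
    case (Cons j w)
    let ?s = "if j = i then Poly_Mapping.single (Word w) 1 else 0 :: word \<Rightarrow>\<^sub>0 'a"
    have "u \<in> Poly_Mapping.keys ?s \<or> u \<in> Poly_Mapping.keys (scal (Q j i) * (gen j * skew_word Q i w))"
      using Cons.prems keys_add[of ?s "scal (Q j i) * (gen j * skew_word Q i w)"] by auto
    then show ?case
    proof
      assume u: "u \<in> Poly_Mapping.keys (scal (Q j i) * (gen j * skew_word Q i w))"
      then obtain v where v: "v \<in> Poly_Mapping.keys (gen j * skew_word Q i w)" "u = v"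
        using keys[OF u] by (auto split: if_splits)
      then obtain v' where v': "v' \<in> Poly_Mapping.keys (skew_word Q i w)" "v = Word [j] + v'"
        using keys[OF v(1)] by (auto split: if_splits)
      then show ?thesis
        using Cons.IH[of v'] v(2) by (simp add: plus_word_def)
    qed (auto split: if_splits)
  qed auto
  obtain u where "u \<in> Poly_Mapping.keys p" "v \<in> Poly_Mapping.keys (skew_word Q i (letters u))"
    using assms keys_lin_ext[of "\<lambda>w. skew_word Q i (letters w)" p] unfolding skew_def by blast
  then show ?thesis using word by blast
qed

lemma skew_tensor_power:
  assumes "p \<in> tensor_power n (Suc m)"
  shows "skew Q i p \<in> tensor_power n m"
proof -
  have "set (letters v) \<subseteq> {1..n} \<and> length (letters v) = m"
    if v: "v \<in> Poly_Mapping.keys (skew Q i p)" for v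
  proof -
    obtain u where u: "u \<in> Poly_Mapping.keys p" "mset (letters u) = add_mset i (mset (letters v))"
      using keys_skew[OF v] by blast
    then have "set (letters u) = insert i (set (letters v))" "length (letters u) = Suc (length (letters v))"
      by (metis set_mset_add_mset_insert set_mset_mset) (metis size_add_mset size_mset u(2))
    then show ?thesis
      using u(1) assms by (fastforce simp: tensor_power_def tensor_algebra_def)
  qed
  then show ?thesis
    by (auto simp: tensor_power_def tensor_algebra_def)
qed

section \<open>Iterated skew derivations\<close>

fun skew_list :: "(nat \<Rightarrow> nat \<Rightarrow> 'a::field) \<Rightarrow> nat list \<Rightarrow> (word \<Rightarrow>\<^sub>0 'a) \<Rightarrow> (word \<Rightarrow>\<^sub>0 'a)" where
  "skew_list Q [] p = p"
| "skew_list Q (i # w) p = skew_list Q w (skew Q i p)"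

lemma skew_list_zero [simp]: "skew_list Q w 0 = 0"
  by (induction w) auto

lemma skew_list_add: "skew_list Q w (p + q) = skew_list Q w p + skew_list Q w q"
  by (induction w arbitrary: p q) (auto simp: skew_add)

lemma skew_list_scal_mult: "skew_list Q w (scal c * p) = scal c * skew_list Q w p"
  by (induction w arbitrary: p) (auto simp: skew_scal_mult)

lemma skew_list_uminus: "skew_list Q w (- p) = - skew_list Q w p"
  using skew_list_add[of Q w p "- p"] by (simp add: eq_neg_iff_add_eq_0 add.commute)

lemma skew_list_diff: "skew_list Q w (p - q) = skew_list Q w p - skew_list Q w q"
  using skew_list_add[of Q w p "- q"] by (simp add: skew_list_uminus)

lemma skew_list_append: "skew_list Q (v @ w) p = skew_list Q w (skew_list Q v p)"
  by (induction v arbitrary: p) auto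

lemma keys_skew_list:
  "v \<in> Poly_Mapping.keys (skew_list Q w p) \<Longrightarrow>
    \<exists>u\<in>Poly_Mapping.keys p. mset (letters u) = mset w + mset (letters v)"
proof (induction w arbitrary: p)
  case (Cons i w)
  then obtain u where u: "u \<in> Poly_Mapping.keys (skew Q i p)" "mset (letters u) = mset w + mset (letters v)"
    by fastforce
  then show ?case
    using keys_skew[OF u(1)] by auto
qed auto

lemma scal_mult_scal_left: "scal c * (scal d * p) = scal (c * d) * p"
  by (simp add: scal_mult_scal flip: mult.assoc)

text \<open>Since \<open>j\<close> is never deleted, only braiding factors accumulate. For
  multiplication on the right there is not even a factor, and this discrepancy makes commutators
  nonzero.\<close>

lemma skew_list_gen_mult:
  assumes "j \<notin> set w"
  shows "skew_list Q w (gen j * p) = scal (\<Prod>i\<leftarrow>w. Q j i) * (gen j * skew_list Q w p)"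
  using assms
  by (induction w arbitrary: p)
    (auto simp: skew_gen_mult skew_list_scal_mult scal_mult_scal_left)

lemma skew_list_mult_gen:
  assumes "j \<notin> set w"
  shows "skew_list Q w (p * gen j) = skew_list Q w p * gen j"
  using assms by (induction w arbitrary: p) (auto simp: skew_mult_gen)

lemma skew_list_twist:
  "skew_list Q w (twist Q i p) = scal (\<Prod>j\<leftarrow>w. Q j i) * twist Q i (skew_list Q w p)"
  by (induction w arbitrary: p)
    (auto simp: skew_twist skew_list_scal_mult scal_mult_scal_left)

subsection \<open>The quantum symmetrizer\<close>

lemma braid_at_zero [simp]: "braid_at Q i 0 = 0"
  by (simp add: braid_at_def)

lemma braid_at_add: "braid_at Q i (p + q) = braid_at Q i p + braid_at Q i q"
  unfolding braid_at_def
  by (rule setsum_keys_plus_distrib[where f = "\<lambda>w c. Poly_Mapping.single (swap_letters i w)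
      (c * Q (letters w ! i) (letters w ! Suc i))"]) (simp_all add: distrib_right single_add)

lemma braid_at_single:
  "braid_at Q i (Poly_Mapping.single w c) =
    Poly_Mapping.single (swap_letters i w) (c * Q (letters w ! i) (letters w ! Suc i))"
  by (simp add: braid_at_def)

lemma braid_at_Suc_gen_mult: "braid_at Q (Suc i) (gen j * p) = gen j * braid_at Q i p"
proof (induction p rule: poly_mapping_single_induct)
  case (single w c)
  then show ?case
    by (cases w) (simp add: gen_mult_single braid_at_single swap_letters_def)
qed (simp_all add: distrib_left braid_at_add)

lemma braid_at_0_gen_gen:
  "braid_at Q 0 (gen i * (gen j * p)) = scal (Q i j) * (gen j * (gen i * p))"
proof (induction p rule: poly_mapping_single_induct)
  case (single w c)
  then show ?case
    by (cases w) (simp add: gen_mult_single braid_at_single swap_letters_def scal_mult_single mult.commute)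
qed (simp_all add: distrib_left braid_at_add)

lemma braid_chain_zero [simp]: "braid_chain Q k l 0 = 0"
  by (induction l) auto

lemma braid_chain_add: "braid_chain Q k l (p + q) = braid_chain Q k l p + braid_chain Q k l q"
  by (induction l arbitrary: p q) (auto simp: braid_at_add)

lemma braid_chain_Suc_gen_mult: "braid_chain Q (Suc k) l (gen j * p) = gen j * braid_chain Q k l p"
  by (induction l arbitrary: p) (auto simp: braid_at_Suc_gen_mult)

lemma braid_chain_Suc_left: "braid_chain Q k (Suc l) p = braid_at Q k (braid_chain Q (Suc k) l p)"
  by (induction l arbitrary: p) auto

lemma braid_sum_zero [simp]: "braid_sum Q k j 0 = 0"
  by (simp add: braid_sum_def)

lemma braid_sum_add: "braid_sum Q k j (p + q) = braid_sum Q k j p + braid_sum Q k j q"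
  by (simp add: braid_sum_def braid_chain_add sum.distrib)

lemma braid_sum_Suc_gen_mult: "braid_sum Q (Suc k) j (gen i * p) = gen i * braid_sum Q k j p"
  by (simp add: braid_sum_def braid_chain_Suc_gen_mult sum_distrib_left)

lemma braid_at_sum: "braid_at Q i (sum f A) = (\<Sum>a\<in>A. braid_at Q i (f a))"
  by (induction A rule: infinite_finite_induct) (auto simp: braid_at_add)

text \<open>This is S_{1,j+1} = id + C_0 (id \<otimes> S_{1,j}), the counterpart of the recursion of
  the skew derivations on the first letter.\<close>

lemma braid_sum_0_Suc_gen_mult:
  "braid_sum Q 0 (Suc j) (gen i * p) = gen i * p + braid_at Q 0 (gen i * braid_sum Q 0 j p)"
proof -
  have "braid_sum Q 0 (Suc j) (gen i * p) = gen i * p + (\<Sum>l\<le>j. braid_chain Q 0 (Suc l) (gen i * p))"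
    unfolding braid_sum_def by (subst sum.atMost_Suc_shift) simp
  also have "(\<Sum>l\<le>j. braid_chain Q 0 (Suc l) (gen i * p)) = braid_at Q 0 (gen i * braid_sum Q 0 j p)"
    by (simp add: braid_chain_Suc_left braid_chain_Suc_gen_mult braid_sum_def sum_distrib_left braid_at_sum
        del: braid_chain.simps)
  finally show ?thesis .
qed

text \<open>The chain C_0 ... C_{l-1} carries the letter in position l to the front and collects
  exactly the weight with which the skew derivation deletes it. Grouping by the letter brought to
  the front gives the sum.\<close>

lemma braid_sum_skew:
  assumes "p \<in> tensor_power n (Suc m)"
  shows "braid_sum Q 0 m p = (\<Sum>i\<in>{1..n}. gen i * skew Q i p)"
proof -
  have word: "braid_sum Q 0 m (Poly_Mapping.single (Word w) c) =
      (\<Sum>i\<in>{1..n}. gen i * skew Q i (Poly_Mapping.single (Word w) c))"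
    if "set w \<subseteq> {1..n}" "length w = Suc m" for w c
    using that
  proof (induction m arbitrary: w)
    case 0
    then obtain j where j: "w = [j]" "j \<in> {1..n}"
      by (auto simp: length_Suc_conv)
    have "gen i * skew Q i (gen j * scal c) = (if j = i then gen j * scal c else 0)" for i
      by (simp add: skew_gen_mult)
    then have "(\<Sum>i\<in>{1..n}. gen i * skew Q i (gen j * scal c)) = gen j * scal c"
      using j(2) by simp
    then show ?case
      using j(1) gen_mult_single[of j "[]" c] by (simp add: braid_sum_def zero_word_def)
  next
    case (Suc m)
    then obtain j v where j: "w = j # v" "j \<in> {1..n}" "set v \<subseteq> {1..n}" "length v = Suc m"
      by (auto simp: length_Suc_conv)
    let ?p = "Poly_Mapping.single (Word v) c"
    have "braid_sum Q 0 (Suc m) (gen j * ?p) = gen j * ?p + braid_at Q 0 (gen j * (\<Sum>i\<in>{1..n}. gen i * skew Q i ?p))"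
      using Suc.IH[OF j(3,4)] by (simp add: braid_sum_0_Suc_gen_mult)
    also have "\<dots> = gen j * ?p + (\<Sum>i\<in>{1..n}. gen i * (scal (Q j i) * (gen j * skew Q i ?p)))"
      by (simp add: sum_distrib_left braid_at_sum braid_at_0_gen_gen gen_scal_left_commute)
    \<comment> \<open>The identity term becomes the summand at \<open>i = j\<close>, where the
      derivation deletes the first letter.\<close>
    also have "\<dots> = (\<Sum>i\<in>{1..n}. (if j = i then gen j * ?p else 0) + gen i * (scal (Q j i) * (gen j * skew Q i ?p)))"
      using j(2) by (simp add: sum.distrib)
    also have "\<dots> = (\<Sum>i\<in>{1..n}. gen i * skew Q i (gen j * ?p))"
      by (intro sum.cong) (simp_all add: skew_gen_mult distrib_left)
    finally show ?case
      by (simp add: gen_mult_single j(1))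
  qed
  show ?thesis
  proof (induction p rule: poly_mapping_single_induct)
    case (single w c)
    then show ?case
      using word[of "letters w" c] assms by (auto simp: tensor_power_def tensor_algebra_def)
  qed (auto simp: braid_sum_add skew_add distrib_left sum.distrib)
qed

lemma symmetrizer_prod_zero [simp]: "symmetrizer_prod Q m j 0 = 0"
  by (induction j) auto

lemma symmetrizer_prod_add:
  "symmetrizer_prod Q m j (p + q) = symmetrizer_prod Q m j p + symmetrizer_prod Q m j q"
  by (induction j arbitrary: p q) (auto simp: braid_sum_add)

lemma symmetrizer_prod_sum: "symmetrizer_prod Q m j (sum f A) = (\<Sum>a\<in>A. symmetrizer_prod Q m j (f a))"
  by (induction A rule: infinite_finite_induct) (auto simp: symmetrizer_prod_add)

text \<open>On \<open>Suc m\<close> tensor factors the leftmost \<open>j\<close> operators start at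
  position \<open>m - j\<close> or later, which is at least 1, so they fix the first letter.\<close>

lemma symmetrizer_prod_Suc_gen_mult:
  "j < m \<Longrightarrow> symmetrizer_prod Q (Suc m) j (gen i * p) = gen i * symmetrizer_prod Q m j p"
proof (induction j arbitrary: p)
  case (Suc j)
  then have "Suc m - Suc (Suc j) = Suc (m - Suc (Suc j))"
    by simp
  with Suc show ?case
    by (simp add: braid_sum_Suc_gen_mult)
qed auto

text \<open>The rightmost factor S_{1,m} acts first and equals the sum of the x_i D_i; the remaining
  factors leave the letter in front alone.\<close>

lemma quantum_symmetrizer_Suc:
  assumes "p \<in> tensor_power n (Suc m)"
  shows "quantum_symmetrizer Q (Suc m) p = (\<Sum>i\<in>{1..n}. gen i * quantum_symmetrizer Q m (skew Q i p))"
proof (cases m)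
  \<comment> \<open>Both symmetrizers are the identity here, because \<open>m - 1\<close> truncates
    to 0 for \<open>m = 0\<close>.\<close>
  case 0
  then show ?thesis
    using braid_sum_skew[of p n 0 Q] assms by (simp add: quantum_symmetrizer_def braid_sum_def)
next
  case (Suc k)
  have "quantum_symmetrizer Q (Suc m) p = symmetrizer_prod Q (Suc m) k (braid_sum Q 0 m p)"
    by (simp add: quantum_symmetrizer_def Suc)
  then show ?thesis
    using assms by (simp add: braid_sum_skew symmetrizer_prod_sum symmetrizer_prod_Suc_gen_mult
        quantum_symmetrizer_def Suc)
qed

text \<open>Words with different first letters differ, so the subspaces x_i T(V) are independent,
  and left multiplication by x_i is injective.\<close>

lemma sum_gen_mult_eq_0_iff:
  "(\<Sum>i\<in>{1..n}. gen i * f i) = 0 \<longleftrightarrow> (\<forall>i\<in>{1..n}. f i = 0)"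
proof
  assume zero: "(\<Sum>i\<in>{1..n}. gen i * f i) = 0"
  show "\<forall>i\<in>{1..n}. f i = 0"
  proof
    fix j assume j: "j \<in> {1..n}"
    have "Poly_Mapping.lookup (f j) (Word v) = Poly_Mapping.lookup (\<Sum>i\<in>{1..n}. gen i * f i) (Word (j # v))" for v
      using j by (simp add: lookup_sum lookup_gen_mult)
    then have "Poly_Mapping.lookup (f j) w = 0" for w
      using zero by (cases w) simp
    then show "f j = 0"
      by (intro poly_mapping_eqI) simp
  qed
qed simp

text \<open>Iterating the recursion for S_m, with independence of the x_i at each stage, replaces
  the symmetrizer by skew derivations. From here on the Nichols ideal is handled only in this
  form.\<close>

lemma symmetrizer_kernel_iff:
  "p \<in> symmetrizer_kernel n Q m \<longleftrightarrow>
    p \<in> tensor_power n m \<and> (\<forall>w. set w \<subseteq> {1..n} \<and> length w = m \<longrightarrow> skew_list Q w p = 0)"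
proof (induction m arbitrary: p)
  case 0
  then show ?case
    by (auto simp: symmetrizer_kernel_def quantum_symmetrizer_def)
next
  case (Suc m)
  have "p \<in> symmetrizer_kernel n Q (Suc m) \<longleftrightarrow>
      p \<in> tensor_power n (Suc m) \<and> (\<forall>i\<in>{1..n}. skew Q i p \<in> symmetrizer_kernel n Q m)"
    using skew_tensor_power[of p n m Q]
    by (auto simp: symmetrizer_kernel_def quantum_symmetrizer_Suc sum_gen_mult_eq_0_iff simp del: One_nat_def)
  also have "\<dots> \<longleftrightarrow> p \<in> tensor_power n (Suc m) \<and>
      (\<forall>i\<in>{1..n}. \<forall>w. set w \<subseteq> {1..n} \<and> length w = m \<longrightarrow> skew_list Q (i # w) p = 0)"
    using skew_tensor_power[of p n m Q] by (auto simp: Suc.IH)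
  also have "\<dots> \<longleftrightarrow> p \<in> tensor_power n (Suc m) \<and>
      (\<forall>w. set w \<subseteq> {1..n} \<and> length w = Suc m \<longrightarrow> skew_list Q w p = 0)"
  proof (intro conj_cong refl iffI allI impI ballI)
    fix w assume hyp: "\<forall>i\<in>{1..n}. \<forall>w. set w \<subseteq> {1..n} \<and> length w = m \<longrightarrow> skew_list Q (i # w) p = 0"
      and w: "set w \<subseteq> {1..n} \<and> length w = Suc m"
    then obtain i v where "w = i # v"
      by (cases w) auto
    with hyp w show "skew_list Q w p = 0"
      by simp
  next
    fix i w assume hyp: "\<forall>w. set w \<subseteq> {1..n} \<and> length w = Suc m \<longrightarrow> skew_list Q w p = 0"
      and "i \<in> {1..n}" "set w \<subseteq> {1..n} \<and> length w = m"
    then show "skew_list Q (i # w) p = 0"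
      using hyp[rule_format, of "i # w"] by simp
  qed
  finally show ?case .
qed

subsection \<open>The Nichols algebra\<close>

lemma tensor_algebra_simps [simp]:
  "monoid.mult (tensor_algebra n) = (*)"
  "one (tensor_algebra n) = 1"
  "zero (tensor_algebra n) = 0"
  "add (tensor_algebra n) = (+)"
  by (simp_all add: tensor_algebra_def)

lemma carrier_tensor_algebra:
  "p \<in> carrier (tensor_algebra n) \<longleftrightarrow> (\<forall>w\<in>Poly_Mapping.keys p. set (letters w) \<subseteq> {1..n})"
  by (simp add: tensor_algebra_def)

lemma carrier_tensor_algebra_add:
  "p \<in> carrier (tensor_algebra n) \<Longrightarrow> q \<in> carrier (tensor_algebra n) \<Longrightarrow> p + q \<in> carrier (tensor_algebra n)"
  using keys_add[of p q] by (auto simp: carrier_tensor_algebra)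

lemma carrier_tensor_algebra_mult:
  "p \<in> carrier (tensor_algebra n) \<Longrightarrow> q \<in> carrier (tensor_algebra n) \<Longrightarrow> p * q \<in> carrier (tensor_algebra n)"
  using keys_mult[of p q] by (fastforce simp: carrier_tensor_algebra plus_word_def)

lemma carrier_tensor_algebra_uminus:
  "p \<in> carrier (tensor_algebra n) \<Longrightarrow> - p \<in> carrier (tensor_algebra n)"
  by (simp add: carrier_tensor_algebra in_keys_iff)

lemma carrier_tensor_algebra_scal: "scal c \<in> carrier (tensor_algebra n)"
  by (auto simp: carrier_tensor_algebra zero_word_def)

lemma carrier_tensor_algebra_gen: "i \<in> {1..n} \<Longrightarrow> gen i \<in> carrier (tensor_algebra n)"
  by (simp add: carrier_tensor_algebra)

lemma carrier_tensor_algebra_zero: "0 \<in> carrier (tensor_algebra n)"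
  by (simp add: carrier_tensor_algebra)

lemmas carrier_tensor_algebra_intros =
  carrier_tensor_algebra_add carrier_tensor_algebra_mult carrier_tensor_algebra_uminus
  carrier_tensor_algebra_scal carrier_tensor_algebra_gen carrier_tensor_algebra_zero

lemma ring_tensor_algebra: "ring (tensor_algebra n :: (word \<Rightarrow>\<^sub>0 'a::field) ring)"
proof (intro ringI abelian_groupI monoidI)
  fix p :: "word \<Rightarrow>\<^sub>0 'a"
  assume "p \<in> carrier (tensor_algebra n)"
  then show "\<exists>q\<in>carrier (tensor_algebra n). q \<oplus>\<^bsub>tensor_algebra n\<^esub> p = \<zero>\<^bsub>tensor_algebra n\<^esub>"
    by (intro bexI[of _ "- p"]) (auto intro: carrier_tensor_algebra_intros)
next
  show "\<one>\<^bsub>tensor_algebra n\<^esub> \<in> carrier (tensor_algebra n :: (word \<Rightarrow>\<^sub>0 'a) ring)"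
    by (simp add: carrier_tensor_algebra zero_word_def)
qed (auto simp: algebra_simps intro: carrier_tensor_algebra_intros)

lemma tensor_algebra_a_inv:
  assumes "p \<in> carrier (tensor_algebra n)"
  shows "\<ominus>\<^bsub>tensor_algebra n\<^esub> p = - p"
proof -
  interpret ring "tensor_algebra n :: (word \<Rightarrow>\<^sub>0 'a) ring" by (rule ring_tensor_algebra)
  show ?thesis
    using minus_equality[of "- p" p] assms by (auto intro: carrier_tensor_algebra_intros)
qed

lemma tensor_power_add: "p \<in> tensor_power n m \<Longrightarrow> q \<in> tensor_power n m \<Longrightarrow> p + q \<in> tensor_power n m"
  using keys_add[of p q] by (auto simp: tensor_power_def intro: carrier_tensor_algebra_intros)

lemma tensor_power_mult:
  "p \<in> tensor_power n k \<Longrightarrow> q \<in> tensor_power n l \<Longrightarrow> p * q \<in> tensor_power n (k + l)"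
  using keys_mult[of p q]
  by (fastforce simp: tensor_power_def plus_word_def intro: carrier_tensor_algebra_intros)

lemma tensor_power_scal: "scal c \<in> tensor_power n 0"
  using carrier_tensor_algebra_scal[of c n] by (auto simp: tensor_power_def zero_word_def split: if_splits)

lemma tensor_power_gen: "i \<in> {1..n} \<Longrightarrow> gen i \<in> tensor_power n 1"
  by (simp add: tensor_power_def carrier_tensor_algebra)

lemma symmetrizer_kernel_add:
  "p \<in> symmetrizer_kernel n Q m \<Longrightarrow> q \<in> symmetrizer_kernel n Q m \<Longrightarrow> p + q \<in> symmetrizer_kernel n Q m"
  by (simp add: symmetrizer_kernel_iff tensor_power_add skew_list_add)

lemma symmetrizer_kernel_zero: "0 \<in> symmetrizer_kernel n Q m"
  by (simp add: symmetrizer_kernel_iff tensor_power_def carrier_tensor_algebra_zero)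

lemma symmetrizer_kernel_scal_mult:
  "p \<in> symmetrizer_kernel n Q m \<Longrightarrow> scal c * p \<in> symmetrizer_kernel n Q m"
  using tensor_power_mult[OF tensor_power_scal, of p n m c]
  by (simp add: symmetrizer_kernel_iff skew_list_scal_mult)

text \<open>The first derivation applied either removes the new x_i, leaving \<open>p\<close>, or
  acts on \<open>p\<close> and leaves a tensor one degree lower that again is killed. The induction
  carries only this vanishing property.\<close>

lemma symmetrizer_kernel_gen_mult:
  assumes "p \<in> symmetrizer_kernel n Q m" "i \<in> {1..n}"
  shows "gen i * p \<in> symmetrizer_kernel n Q (Suc m)"
proof -
  have "skew_list Q w (gen i * p) = 0"
    if "\<And>w. set w \<subseteq> {1..n} \<Longrightarrow> length w = m \<Longrightarrow> skew_list Q w p = 0"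
      "set w \<subseteq> {1..n}" "length w = Suc m" for w
    using that
  proof (induction m arbitrary: p w)
    case 0
    then show ?case using "0.prems"(1)[of "[]"] by simp
  next
    case (Suc m)
    then obtain j v where w: "w = j # v" "set v \<subseteq> {1..n}" "length v = Suc m" "j \<in> {1..n}"
      by (cases w) auto
    have "skew_list Q v (gen i * skew Q j p) = 0"
    proof (rule Suc.IH)
      fix u assume "set u \<subseteq> {1..n}" "length u = m"
      then show "skew_list Q u (skew Q j p) = 0"
        using Suc.prems(1)[of "j # u"] w(4) by simp
    qed (use w in auto)
    then show ?case
      using Suc.prems(1)[of v] w by (simp add: skew_gen_mult skew_list_add skew_list_scal_mult)
  qed
  then show ?thesis
    using assms tensor_power_mult[OF tensor_power_gen, of i n p m]
    by (auto simp: symmetrizer_kernel_iff)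
qed

text \<open>As for left multiplication, but the removal of the new letter leaves a twisted
  \<open>p\<close>; the twist commutes with derivations up to scalars and hence preserves
  vanishing.\<close>

lemma symmetrizer_kernel_mult_gen:
  assumes "p \<in> symmetrizer_kernel n Q m" "i \<in> {1..n}"
  shows "p * gen i \<in> symmetrizer_kernel n Q (Suc m)"
proof -
  have "skew_list Q w (p * gen i) = 0"
    if "\<And>w. set w \<subseteq> {1..n} \<Longrightarrow> length w = m \<Longrightarrow> skew_list Q w p = 0"
      "set w \<subseteq> {1..n}" "length w = Suc m" for w
    using that
  proof (induction m arbitrary: p w)
    case 0
    then show ?case using "0.prems"(1)[of "[]"] by simp
  next
    case (Suc m)
    then obtain j v where w: "w = j # v" "set v \<subseteq> {1..n}" "length v = Suc m" "j \<in> {1..n}"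
      by (cases w) auto
    have "skew_list Q v (skew Q j p * gen i) = 0"
    proof (rule Suc.IH)
      fix u assume "set u \<subseteq> {1..n}" "length u = m"
      then show "skew_list Q u (skew Q j p) = 0"
        using Suc.prems(1)[of "j # u"] w(4) by simp
    qed (use w in auto)
    then show ?case
      using Suc.prems(1)[of v] w by (simp add: skew_mult_gen skew_list_add skew_list_twist)
  qed
  then show ?thesis
    using assms tensor_power_mult[OF _ tensor_power_gen, of p n m i]
    by (auto simp: symmetrizer_kernel_iff)
qed

section \<open>The Nichols ideal is two-sided\<close>

lemma nichols_ideal_sum: "(\<And>m. f m \<in> symmetrizer_kernel n Q m) \<Longrightarrow> (\<Sum>m<k. f m) \<in> nichols_ideal n Q"
  by (auto simp: nichols_ideal_def)

lemma nichols_ideal_cases: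
  assumes "p \<in> nichols_ideal n Q"
  obtains f k where "p = (\<Sum>m<k. f m)" "\<And>m. f m \<in> symmetrizer_kernel n Q m"
  using assms by (auto simp: nichols_ideal_def)

lemma nichols_ideal_zero: "0 \<in> nichols_ideal n Q"
  using nichols_ideal_sum[of "\<lambda>_. 0" n Q 0] by (simp add: symmetrizer_kernel_zero)

lemma nichols_ideal_add:
  assumes "p \<in> nichols_ideal n Q" "q \<in> nichols_ideal n Q"
  shows "p + q \<in> nichols_ideal n Q"
proof -
  obtain f k where f: "p = (\<Sum>m<k. f m)" "\<And>m. f m \<in> symmetrizer_kernel n Q m"
    using assms(1) by (blast elim: nichols_ideal_cases)
  obtain g l where g: "q = (\<Sum>m<l. g m)" "\<And>m. g m \<in> symmetrizer_kernel n Q m"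
    using assms(2) by (blast elim: nichols_ideal_cases)
  \<comment> \<open>Padding with zeros brings both sums to a common length without changing the
    degree of any component.\<close>
  have "p = (\<Sum>m<max k l. if m < k then f m else 0)" "q = (\<Sum>m<max k l. if m < l then g m else 0)"
    unfolding f g by (rule sum.mono_neutral_cong_left; auto)+
  then have "p + q = (\<Sum>m<max k l. (if m < k then f m else 0) + (if m < l then g m else 0))"
    by (simp add: sum.distrib)
  also have "\<dots> \<in> nichols_ideal n Q"
    by (intro nichols_ideal_sum symmetrizer_kernel_add) (auto simp: f g symmetrizer_kernel_zero)
  finally show ?thesis .
qed

lemma nichols_ideal_scal_mult: "p \<in> nichols_ideal n Q \<Longrightarrow> scal c * p \<in> nichols_ideal n Q"
  by (erule nichols_ideal_cases)
    (simp add: sum_distrib_left nichols_ideal_sum symmetrizer_kernel_scal_mult)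

text \<open>This serves both one-sided multiplications by a generator, each of which raises the
  tensor degree by one.\<close>

lemma nichols_ideal_shift:
  assumes "p \<in> nichols_ideal n Q" "h 0 = 0" "\<And>p q. h (p + q) = h p + h q"
    and h: "\<And>p m. p \<in> symmetrizer_kernel n Q m \<Longrightarrow> h p \<in> symmetrizer_kernel n Q (Suc m)"
  shows "h p \<in> nichols_ideal n Q"
proof -
  obtain f k where f: "p = (\<Sum>m<k. f m)" "\<And>m. f m \<in> symmetrizer_kernel n Q m"
    using assms(1) by (blast elim: nichols_ideal_cases)
  have "h (\<Sum>m<k. f m) = (\<Sum>m<k. h (f m))" for k
    by (induction k) (auto simp: assms)
  \<comment> \<open>After the shift the component of degree 0 is zero and the sum is one term
    longer.\<close>
  then have "h p = (\<Sum>m<Suc k. case m of 0 \<Rightarrow> 0 | Suc m \<Rightarrow> h (f m))"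
    unfolding f by (subst sum.lessThan_Suc_shift) simp
  also have "\<dots> \<in> nichols_ideal n Q"
    by (intro nichols_ideal_sum) (auto simp: symmetrizer_kernel_zero h f split: nat.split)
  finally show ?thesis .
qed

lemma nichols_ideal_mult_left:
  assumes "p \<in> nichols_ideal n Q" "q \<in> carrier (tensor_algebra n)"
  shows "q * p \<in> nichols_ideal n Q"
  using assms(2)[unfolded carrier_tensor_algebra]
proof (induction q rule: tensor_induct)
  case (gen i q)
  have "gen i * (q * p) \<in> nichols_ideal n Q"
    by (rule nichols_ideal_shift[where h = "\<lambda>p. gen i * p"])
      (auto simp: distrib_left intro: symmetrizer_kernel_gen_mult gen)
  then show ?case
    by (simp add: mult.assoc)
qed (auto simp: distrib_right intro: nichols_ideal_scal_mult nichols_ideal_add assms)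

lemma nichols_ideal_mult_right:
  assumes "p \<in> nichols_ideal n Q" "q \<in> carrier (tensor_algebra n)"
  shows "p * q \<in> nichols_ideal n Q"
proof -
  \<comment> \<open>The quantifier over \<open>p\<close> is kept in the induction because the first
    letter of the right factor is absorbed into \<open>p\<close>.\<close>
  have "\<forall>p\<in>nichols_ideal n Q. p * q \<in> nichols_ideal n Q"
    using assms(2)[unfolded carrier_tensor_algebra]
  proof (induction q rule: tensor_induct)
    case (gen i q)
    have "p * gen i \<in> nichols_ideal n Q" if "p \<in> nichols_ideal n Q" for p
      by (rule nichols_ideal_shift[where h = "\<lambda>p. p * gen i"])
        (auto simp: distrib_right intro: symmetrizer_kernel_mult_gen gen that)
    with gen show ?case
      by (simp flip: mult.assoc)
  qed (auto simp: distrib_left scal_mult_commute intro: nichols_ideal_scal_mult nichols_ideal_add)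
  with assms(1) show ?thesis by blast
qed

lemma nichols_ideal_subset: "nichols_ideal n Q \<subseteq> carrier (tensor_algebra n)"
proof
  fix p assume "p \<in> nichols_ideal n Q"
  then obtain f k where f: "p = (\<Sum>m<k. f m)" "\<And>m. f m \<in> symmetrizer_kernel n Q m"
    by (blast elim: nichols_ideal_cases)
  have "f m \<in> carrier (tensor_algebra n)" for m
    using f(2)[of m] by (simp add: symmetrizer_kernel_def tensor_power_def)
  then show "p \<in> carrier (tensor_algebra n)"
    unfolding f by (induction k) (auto intro: carrier_tensor_algebra_intros)
qed

lemma ideal_nichols_ideal: "ideal (nichols_ideal n Q) (tensor_algebra n)"
proof (rule idealI)
  show "subgroup (nichols_ideal n Q) (add_monoid (tensor_algebra n))"
  proof
    fix p assume p: "p \<in> nichols_ideal n Q"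
    then have "inv\<^bsub>add_monoid (tensor_algebra n)\<^esub> p = - p"
      using tensor_algebra_a_inv nichols_ideal_subset by (fastforce simp: a_inv_def)
    moreover have "- p = scal (-1) * p"
      by (simp add: single_uminus)
    ultimately show "inv\<^bsub>add_monoid (tensor_algebra n)\<^esub> p \<in> nichols_ideal n Q"
      using p nichols_ideal_scal_mult by metis
  qed (use nichols_ideal_subset in \<open>auto intro: nichols_ideal_add nichols_ideal_zero\<close>)
qed (auto intro: ring_tensor_algebra nichols_ideal_mult_left nichols_ideal_mult_right)

subsection \<open>Detecting nonzero elements\<close>

text \<open>The zero word is the empty word, so this is the constant term. It is a linear functional
  on T(V), and on tensors of the multidegree of \<open>w\<close> it is the whole value of
  \<open>skew_list\<close>.\<close>

definition skew_coeff :: "(nat \<Rightarrow> nat \<Rightarrow> 'a::field) \<Rightarrow> nat list \<Rightarrow> (word \<Rightarrow>\<^sub>0 'a) \<Rightarrow> 'a" where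
  "skew_coeff Q w p = Poly_Mapping.lookup (skew_list Q w p) 0"

lemma skew_coeff_zero [simp]: "skew_coeff Q w 0 = 0"
  and skew_coeff_add: "skew_coeff Q w (p + q) = skew_coeff Q w p + skew_coeff Q w q"
  by (simp_all add: skew_coeff_def skew_list_add lookup_add)

lemma skew_coeff_scal_mult: "skew_coeff Q w (scal c * p) = c * skew_coeff Q w p"
  by (simp add: skew_coeff_def skew_list_scal_mult lookup_scal_mult)

lemma skew_coeff_eq_0:
  assumes "\<And>u. u \<in> Poly_Mapping.keys p \<Longrightarrow> mset (letters u) \<noteq> mset w"
  shows "skew_coeff Q w p = 0"
  using keys_skew_list[of 0 Q w p] assms
  by (fastforce simp: skew_coeff_def zero_word_def simp flip: not_in_keys_iff_lookup_eq_zero)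

text \<open>The functional thus descends to the Nichols algebra. The component of degree
  \<open>length w\<close> is killed by the description of the kernel, the others for reasons of
  degree.\<close>

lemma skew_coeff_nichols_ideal:
  assumes "p \<in> nichols_ideal n Q" "set w \<subseteq> {1..n}"
  shows "skew_coeff Q w p = 0"
proof -
  obtain f k where f: "p = (\<Sum>m<k. f m)" "\<And>m. f m \<in> symmetrizer_kernel n Q m"
    using assms(1) by (blast elim: nichols_ideal_cases)
  have "skew_coeff Q w (f m) = 0" for m
  proof (cases "m = length w")
    case True
    then show ?thesis
      using f(2)[of m] assms(2) by (simp add: symmetrizer_kernel_iff skew_coeff_def)
  next
    case False
    then show ?thesis
      using f(2)[of m]
      by (intro skew_coeff_eq_0) (auto simp: symmetrizer_kernel_def tensor_power_def dest: mset_eq_length)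
  qed
  then show ?thesis
    unfolding f by (induction k) (auto simp: skew_coeff_add)
qed

section \<open>The quotient ring and its ground field\<close>

lemma ring_hom_nichols_class:
  "ring_hom_ring (tensor_algebra n) (nichols_algebra n Q) (nichols_class n Q)"
  unfolding nichols_algebra_def nichols_class_def[abs_def]
  by (rule ideal.rcos_ring_hom_ring) (rule ideal_nichols_ideal)

lemma ring_nichols_algebra: "ring (nichols_algebra n Q)"
  by (meson ring_hom_nichols_class ring_hom_ring.axioms(2))

lemma nichols_class_add:
  "p \<in> carrier (tensor_algebra n) \<Longrightarrow> q \<in> carrier (tensor_algebra n) \<Longrightarrow>
    nichols_class n Q p \<oplus>\<^bsub>nichols_algebra n Q\<^esub> nichols_class n Q q = nichols_class n Q (p + q)"
  and nichols_class_mult: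
  "p \<in> carrier (tensor_algebra n) \<Longrightarrow> q \<in> carrier (tensor_algebra n) \<Longrightarrow>
    nichols_class n Q p \<otimes>\<^bsub>nichols_algebra n Q\<^esub> nichols_class n Q q = nichols_class n Q (p * q)"
  and nichols_class_zero: "nichols_class n Q 0 = \<zero>\<^bsub>nichols_algebra n Q\<^esub>"
  and nichols_class_one: "nichols_class n Q 1 = \<one>\<^bsub>nichols_algebra n Q\<^esub>"
  and nichols_class_closed:
  "p \<in> carrier (tensor_algebra n) \<Longrightarrow> nichols_class n Q p \<in> carrier (nichols_algebra n Q)"
  and nichols_class_diff:
  "p \<in> carrier (tensor_algebra n) \<Longrightarrow> q \<in> carrier (tensor_algebra n) \<Longrightarrow>
    nichols_class n Q p \<ominus>\<^bsub>nichols_algebra n Q\<^esub> nichols_class n Q q = nichols_class n Q (p - q)"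
proof -
  interpret hom: ring_hom_ring "tensor_algebra n" "nichols_algebra n Q" "nichols_class n Q"
    by (rule ring_hom_nichols_class)
  show "p \<in> carrier (tensor_algebra n) \<Longrightarrow> q \<in> carrier (tensor_algebra n) \<Longrightarrow>
    nichols_class n Q p \<oplus>\<^bsub>nichols_algebra n Q\<^esub> nichols_class n Q q = nichols_class n Q (p + q)"
    using hom.hom_add[of p q] by simp
  show "p \<in> carrier (tensor_algebra n) \<Longrightarrow> q \<in> carrier (tensor_algebra n) \<Longrightarrow>
    nichols_class n Q p \<otimes>\<^bsub>nichols_algebra n Q\<^esub> nichols_class n Q q = nichols_class n Q (p * q)"
    using hom.hom_mult[of p q] by simp
  show "nichols_class n Q 0 = \<zero>\<^bsub>nichols_algebra n Q\<^esub>"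
    using hom.hom_zero by simp
  show "nichols_class n Q 1 = \<one>\<^bsub>nichols_algebra n Q\<^esub>"
    using hom.hom_one by simp
  show "p \<in> carrier (tensor_algebra n) \<Longrightarrow> nichols_class n Q p \<in> carrier (nichols_algebra n Q)"
    by simp
  show "p \<in> carrier (tensor_algebra n) \<Longrightarrow> q \<in> carrier (tensor_algebra n) \<Longrightarrow>
    nichols_class n Q p \<ominus>\<^bsub>nichols_algebra n Q\<^esub> nichols_class n Q q = nichols_class n Q (p - q)"
    using hom.hom_add[of p "- q"] hom.hom_a_inv[of q]
    by (simp add: a_minus_def tensor_algebra_a_inv carrier_tensor_algebra_uminus)
qed

lemma skew_coeff_eq_if_nichols_class_eq:
  assumes "nichols_class n Q p = nichols_class n Q q" "p \<in> carrier (tensor_algebra n)" "set w \<subseteq> {1..n}"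
  shows "skew_coeff Q w p = skew_coeff Q w q"
proof -
  interpret ideal "nichols_ideal n Q" "tensor_algebra n"
    by (rule ideal_nichols_ideal)
  have "p \<in> nichols_class n Q q"
    using a_rcos_self[OF assms(2)] assms(1) by (simp add: nichols_class_def)
  then obtain h where "h \<in> nichols_ideal n Q" "p = h + q"
    by (auto simp: nichols_class_def a_r_coset_def')
  then show ?thesis
    using skew_coeff_nichols_ideal[OF _ assms(3)] by (simp add: skew_coeff_add)
qed

lemma subfield_nichols_scalars: "subfield (nichols_scalars n Q) (nichols_algebra n Q)"
proof -
  \<comment> \<open>The type-class field is repackaged as a ring record, so that the scalars become
    the image of a field under a ring homomorphism.\<close>
  let ?F = "\<lparr>carrier = UNIV, monoid.mult = (*), one = 1, zero = 0, add = (+)\<rparr> :: 'a ring"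
  have "\<exists>b. b + a = 0" for a :: 'a
    by (metis left_minus)
  then have "cring ?F"
    by (intro cringI abelian_groupI comm_monoidI) (auto simp: algebra_simps)
  then interpret F: field ?F
    by (rule cring.cring_fieldI2) (auto intro: right_inverse)
  interpret B: ring "nichols_algebra n Q"
    by (rule ring_nichols_algebra)
  interpret hom: ring_hom_ring ?F "nichols_algebra n Q" "\<lambda>c. nichols_class n Q (scal c)"
    by unfold_locales (auto simp: ring_hom_def nichols_class_closed nichols_class_add nichols_class_mult
        carrier_tensor_algebra_scal scal_mult_scal single_add nichols_class_one)
  \<comment> \<open>The constant term separates 1 from 0, so the quotient is not the zero
    ring.\<close>
  have "skew_coeff Q [] 1 \<noteq> skew_coeff Q [] 0"
    by (simp add: skew_coeff_def)
  then have "\<one>\<^bsub>nichols_algebra n Q\<^esub> \<noteq> \<zero>\<^bsub>nichols_algebra n Q\<^esub>"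
    using skew_coeff_eq_if_nichols_class_eq[of n Q 1 0 "[]"] carrier_tensor_algebra_scal[of 1 n]
    by (auto simp: nichols_class_one[symmetric] nichols_class_zero[symmetric])
  then show ?thesis
    using hom.img_is_subfield(2)[OF F.carrier_is_subfield] by (simp add: nichols_scalars_def)
qed

text \<open>Nonvanishing in the quotient is certified by a functional of the same multidegree. The
  word \<open>w\<close> is part of the certificate because it is extended together with
  \<open>p\<close> when brackets are taken.\<close>

definition lie_degree :: "nat \<Rightarrow> (nat \<Rightarrow> nat \<Rightarrow> 'a::field) \<Rightarrow> nat multiset \<Rightarrow> bool" where
  "lie_degree n Q b \<longleftrightarrow> (\<exists>p w. p \<in> carrier (tensor_algebra n) \<and> nichols_class n Q p \<in> nichols_lie n Q \<and>
    (\<forall>u\<in>Poly_Mapping.keys p. mset (letters u) = b) \<and> mset w = b \<and> set w \<subseteq> {1..n} \<and> skew_coeff Q w p \<noteq> 0)"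

text \<open>The functional chosen for one multidegree vanishes on the representatives of all others
  but not on its own.\<close>

lemma independent_nichols_classes:
  assumes "distinct bs"
    and p: "\<And>b. b \<in> set bs \<Longrightarrow> p b \<in> carrier (tensor_algebra n)"
    and homogeneous: "\<And>b u. b \<in> set bs \<Longrightarrow> u \<in> Poly_Mapping.keys (p b) \<Longrightarrow> mset (letters u) = b"
    and w: "\<And>b. b \<in> set bs \<Longrightarrow> mset (w b) = b \<and> set (w b) \<subseteq> {1..n} \<and> skew_coeff Q (w b) (p b) \<noteq> 0"
  shows "ring.independent (nichols_algebra n Q) (nichols_scalars n Q) (map (\<lambda>b. nichols_class n Q (p b)) bs)"
proof -
  interpret B: ring "nichols_algebra n Q"
    by (rule ring_nichols_algebra)
  let ?us = "map (\<lambda>b. nichols_class n Q (p b))"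
  \<comment> \<open>Elements of the span are lifted to T(V), to representatives on which the
    functional of an absent multidegree vanishes.\<close>
  have span: "\<exists>z\<in>carrier (tensor_algebra n). skew_coeff Q v z = 0 \<and> x = nichols_class n Q z"
    if "x \<in> B.Span (nichols_scalars n Q) (?us cs)" "set cs \<subseteq> set bs" "mset v \<notin> set cs" for x v cs
    using that
  proof (induction cs arbitrary: x)
    case Nil
    then show ?case
      using carrier_tensor_algebra_zero[of n] by (auto simp: nichols_class_zero intro!: bexI[of _ 0])
  next
    case (Cons c cs)
    obtain k y where k: "k \<in> nichols_scalars n Q" "y \<in> B.Span (nichols_scalars n Q) (?us cs)"
      "x = k \<otimes>\<^bsub>nichols_algebra n Q\<^esub> nichols_class n Q (p c) \<oplus>\<^bsub>nichols_algebra n Q\<^esub> y"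
      using Cons.prems(1) by (auto simp: B.line_extension_mem_iff)
    obtain d where d: "k = nichols_class n Q (scal d)"
      using k(1) by (auto simp: nichols_scalars_def)
    obtain z where z: "z \<in> carrier (tensor_algebra n)" "skew_coeff Q v z = 0" "y = nichols_class n Q z"
      using Cons.IH[OF k(2)] Cons.prems by auto
    have pc: "p c \<in> carrier (tensor_algebra n)" "skew_coeff Q v (p c) = 0"
      using Cons.prems p homogeneous[of c] by (auto intro!: skew_coeff_eq_0)
    show ?case
    proof (intro bexI conjI)
      show "scal d * p c + z \<in> carrier (tensor_algebra n)"
        using pc z by (intro carrier_tensor_algebra_intros)
      show "skew_coeff Q v (scal d * p c + z) = 0"
        using pc z by (simp add: skew_coeff_add skew_coeff_scal_mult)
      show "x = nichols_class n Q (scal d * p c + z)"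
        using pc z by (simp add: k d nichols_class_add nichols_class_mult carrier_tensor_algebra_intros)
    qed
  qed
  have "B.independent (nichols_scalars n Q) (?us cs)" if "set cs \<subseteq> set bs" "distinct cs" for cs
    using that
  proof (induction cs)
    case (Cons c cs)
    have "nichols_class n Q (p c) \<notin> B.Span (nichols_scalars n Q) (?us cs)"
    proof
      assume "nichols_class n Q (p c) \<in> B.Span (nichols_scalars n Q) (?us cs)"
      then obtain z where "skew_coeff Q (w c) z = 0" "nichols_class n Q (p c) = nichols_class n Q z"
        using span[of "nichols_class n Q (p c)" cs "w c"] Cons.prems w[of c] by auto
      then show False
        using skew_coeff_eq_if_nichols_class_eq[of n Q "p c" z "w c"] p[of c] w[of c] Cons.prems by simp
    qed
    then show ?case
      using Cons p[of c] by (auto intro: B.li_Cons nichols_class_closed)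
  qed auto
  then show ?thesis
    using assms(1) by blast
qed

text \<open>One Lie element per multidegree gives an independent family. If the Lie algebra is
  infinite-dimensional, \<open>ext_dim\<close> is infinite and the bound is immediate.\<close>

lemma card_le_nichols_lie_dim:
  assumes "finite S" "\<And>b. b \<in> S \<Longrightarrow> lie_degree n Q b"
  shows "ereal (real (card S)) \<le> nichols_lie_dim n Q"
proof -
  interpret B: ring "nichols_algebra n Q"
    by (rule ring_nichols_algebra)
  let ?K = "nichols_scalars n Q" and ?L = "nichols_lie n Q"
  obtain bs where bs: "set bs = S" "distinct bs"
    using assms(1) finite_distinct_list by blast
  have "\<forall>b\<in>S. \<exists>p w. p \<in> carrier (tensor_algebra n) \<and> nichols_class n Q p \<in> nichols_lie n Q \<and>
    (\<forall>u\<in>Poly_Mapping.keys p. mset (letters u) = b) \<and> mset w = b \<and> set w \<subseteq> {1..n} \<and> skew_coeff Q w p \<noteq> 0"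
    using assms(2) by (simp add: lie_degree_def)
  then obtain p w where pw: "\<And>b. b \<in> S \<Longrightarrow> p b \<in> carrier (tensor_algebra n) \<and> nichols_class n Q (p b) \<in> ?L \<and>
    (\<forall>u\<in>Poly_Mapping.keys (p b). mset (letters u) = b) \<and> mset (w b) = b \<and> set (w b) \<subseteq> {1..n} \<and>
    skew_coeff Q (w b) (p b) \<noteq> 0"
    by metis
  have indep: "B.independent ?K (map (\<lambda>b. nichols_class n Q (p b)) bs)"
    by (rule independent_nichols_classes[where w = w]) (use bs pw in auto)
  have "card S \<le> B.dim ?K ?L" if "B.finite_dimension ?K ?L"
  proof -
    have "B.dimension (B.dim ?K ?L) ?K ?L"
      using B.finite_dimensionE[OF subfield_nichols_scalars that] by (simp add: over_def)
    then have "length (map (\<lambda>b. nichols_class n Q (p b)) bs) \<le> B.dim ?K ?L"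
      by (rule B.independent_length_le_dimension[OF subfield_nichols_scalars _ indep]) (use bs pw in auto)
    then show ?thesis
      using bs distinct_card by fastforce
  qed
  then show ?thesis
    by (simp add: nichols_lie_dim_def ext_dim_def)
qed

subsection \<open>Degrees occurring in the Nichols Lie algebra\<close>

definition ad_gen :: "nat \<Rightarrow> (word \<Rightarrow>\<^sub>0 'a::field) \<Rightarrow> (word \<Rightarrow>\<^sub>0 'a)" where
  "ad_gen i p = gen i * p - p * gen i"

lemma nichols_class_gen_in_lie: "i \<in> {1..n} \<Longrightarrow> nichols_class n Q (gen i) \<in> nichols_lie n Q"
  unfolding nichols_lie_def by (intro commutator_lie_span.generator imageI tensor_power_gen)

lemma ad_gen_in_lie:
  assumes "i \<in> {1..n}" "p \<in> carrier (tensor_algebra n)" "nichols_class n Q p \<in> nichols_lie n Q"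
  shows "ad_gen i p \<in> carrier (tensor_algebra n)" "nichols_class n Q (ad_gen i p) \<in> nichols_lie n Q"
proof -
  note carrier = assms(2) carrier_tensor_algebra_gen[OF assms(1), where 'a = 'a]
  show "ad_gen i p \<in> carrier (tensor_algebra n)"
    unfolding ad_gen_def diff_conv_add_uminus using assms by (intro carrier_tensor_algebra_intros)
  have "nichols_class n Q (ad_gen i p) =
    nichols_class n Q (gen i) \<otimes>\<^bsub>nichols_algebra n Q\<^esub> nichols_class n Q p
      \<ominus>\<^bsub>nichols_algebra n Q\<^esub> nichols_class n Q p \<otimes>\<^bsub>nichols_algebra n Q\<^esub> nichols_class n Q (gen i)"
    using carrier by (simp add: ad_gen_def nichols_class_mult nichols_class_diff carrier_tensor_algebra_mult)
  also have "\<dots> \<in> nichols_lie n Q"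
    using assms nichols_class_gen_in_lie[OF assms(1), of Q]
    unfolding nichols_lie_def by (intro commutator_lie_span.bracket) auto
  finally show "nichols_class n Q (ad_gen i p) \<in> nichols_lie n Q" .
qed

lemma keys_ad_gen:
  assumes "\<And>u. u \<in> Poly_Mapping.keys p \<Longrightarrow> mset (letters u) = b" "u \<in> Poly_Mapping.keys (ad_gen i p)"
  shows "mset (letters u) = add_mset i b"
proof -
  have "u \<in> Poly_Mapping.keys (gen i * p) \<or> u \<in> Poly_Mapping.keys (p * gen i)"
    using assms(2) by (auto simp: ad_gen_def in_keys_iff lookup_minus)
  moreover have "v \<in> Poly_Mapping.keys (q * r) \<Longrightarrow>
      \<exists>s\<in>Poly_Mapping.keys q. \<exists>t\<in>Poly_Mapping.keys r. v = s + t" for v and q r :: "word \<Rightarrow>\<^sub>0 'a"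
    using keys_mult[of q r] by blast
  ultimately show ?thesis
    using assms(1) by (fastforce simp: plus_word_def)
qed

text \<open>Left multiplication by x_i contributes the factor given by the product of the
  \<open>Q i j\<close>, right multiplication contributes 1, and powers of x_i commute with x_i. Each
  bracket therefore multiplies by the difference.\<close>

lemma skew_list_funpow_ad_gen:
  assumes "i \<notin> set w" "skew_list Q w p = scal c"
  shows "skew_list Q w ((ad_gen i ^^ k) p) = scal (((\<Prod>j\<leftarrow>w. Q i j) - 1) ^ k * c) * gen i ^ k"
proof (induction k)
  case (Suc k)
  let ?x = "\<Prod>j\<leftarrow>w. Q i j"
  let ?c = "(?x - 1) ^ k * c"
  have "skew_list Q w ((ad_gen i ^^ Suc k) p) =
      scal ?x * (gen i * (scal ?c * gen i ^ k)) - scal ?c * gen i ^ k * gen i"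
    by (simp add: ad_gen_def skew_list_diff skew_list_gen_mult skew_list_mult_gen assms(1) Suc
        del: power_Suc)
  also have "\<dots> = scal (?x * ?c) * gen i ^ Suc k - scal ?c * gen i ^ Suc k"
    by (simp add: gen_scal_left_commute scal_mult_scal_left mult.assoc power_commutes)
  also have "\<dots> = scal (?x * ?c - ?c) * gen i ^ Suc k"
    by (simp only: single_diff left_diff_distrib)
  also have "?x * ?c - ?c = (?x - 1) ^ Suc k * c"
    by (simp add: algebra_simps)
  finally show ?case .
qed (use assms in simp)

text \<open>The coefficient is the quantum integer (k+1) at q_ii. Iteration yields the quantum
  factorial, whose nonvanishing keeps x_i^k nonzero in the Nichols algebra.\<close>

lemma skew_gen_power: "skew Q i (gen i ^ Suc k) = scal (\<Sum>l\<le>k. Q i i ^ l) * gen i ^ k"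
proof (induction k)
  case 0
  then show ?case
    using skew_gen_mult[of Q i i 1] skew_scal[of Q i 1] by simp
next
  case (Suc k)
  have "skew Q i (gen i ^ Suc (Suc k)) = gen i ^ Suc k + scal (Q i i) * (gen i * (scal (\<Sum>l\<le>k. Q i i ^ l) * gen i ^ k))"
    unfolding power_Suc[of "gen i" "Suc k"] using Suc by (simp add: skew_gen_mult del: power_Suc)
  also have "\<dots> = scal 1 * gen i ^ Suc k + scal (Q i i * (\<Sum>l\<le>k. Q i i ^ l)) * gen i ^ Suc k"
    by (simp add: gen_scal_left_commute scal_mult_scal_left)
  also have "\<dots> = scal (\<Sum>l\<le>Suc k. Q i i ^ l) * gen i ^ Suc k"
    by (subst sum.atMost_Suc_shift) (simp only: distrib_right[symmetric] single_add[symmetric] sum_distrib_left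
        power_Suc power_0)
  finally show ?case .
qed

lemma skew_list_gen_power:
  "skew_list Q (replicate k i) (gen i ^ k) = scal (\<Prod>m<k. \<Sum>l\<le>m. Q i i ^ l)"
  by (induction k) (simp_all add: skew_gen_power skew_list_scal_mult scal_mult_scal mult.commute del: power_Suc)

lemma lie_degree_single:
  assumes "i \<in> {1..n}"
  shows "lie_degree n Q {#i#}"
proof -
  have "skew_coeff Q [i] (gen i) = 1"
    using skew_list_gen_power[of Q 1 i] by (simp add: skew_coeff_def)
  then show ?thesis
    unfolding lie_degree_def
    using assms carrier_tensor_algebra_gen[OF assms, where 'a = 'a] nichols_class_gen_in_lie[OF assms, of Q]
    by (intro exI[of _ "gen i"] exI[of _ "[i]"]) auto
qed

text \<open>The certificate is extended in two stages: \<open>w\<close> reduces the iterated bracket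
  to a multiple of x_i^k, and \<open>k\<close> further derivations reduce that power to a quantum
  factorial.\<close>

lemma lie_degree_ad:
  assumes "lie_degree n Q b" "i \<in> {1..n}" "i \<notin># b"
    and braiding: "(\<Prod>j\<in>#b. Q i j) \<noteq> 1"
    and qint: "\<And>m. m < k \<Longrightarrow> (\<Sum>l\<le>m. Q i i ^ l) \<noteq> 0"
  shows "lie_degree n Q (b + replicate_mset k i)"
proof -
  obtain p w where p: "p \<in> carrier (tensor_algebra n)" "nichols_class n Q p \<in> nichols_lie n Q"
      "\<And>u. u \<in> Poly_Mapping.keys p \<Longrightarrow> mset (letters u) = b"
    and w: "mset w = b" "set w \<subseteq> {1..n}" "skew_coeff Q w p \<noteq> 0"
    using assms(1) by (auto simp: lie_degree_def)
  \<comment> \<open>As \<open>p\<close> and \<open>w\<close> have the same multidegree, no letters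
    survive.\<close>
  have "v = 0" if "v \<in> Poly_Mapping.keys (skew_list Q w p)" for v
    using keys_skew_list[OF that] p(3) w(1) by (cases v) (auto simp: zero_word_def)
  then have c: "skew_list Q w p = scal (skew_coeff Q w p)"
    by (intro poly_mapping_eqI) (auto simp: lookup_single when_def skew_coeff_def in_keys_iff)
  have i: "i \<notin> set w"
    using assms(3) w(1) by auto
  have prod: "(\<Prod>j\<leftarrow>w. Q i j) = (\<Prod>j\<in>#b. Q i j)"
    using w(1) by (metis mset_map prod_mset_prod_list)
  let ?p = "(ad_gen i ^^ k) p" and ?w = "w @ replicate k i"
  have "?p \<in> carrier (tensor_algebra n) \<and> nichols_class n Q ?p \<in> nichols_lie n Q \<and>
      (\<forall>u\<in>Poly_Mapping.keys ?p. mset (letters u) = b + replicate_mset k i)"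
  proof (induction k)
    case (Suc k)
    then have "mset (letters u) = add_mset i (b + replicate_mset k i)"
      if "u \<in> Poly_Mapping.keys (ad_gen i ((ad_gen i ^^ k) p))" for u
      using keys_ad_gen[OF _ that] by blast
    with Suc show ?case
      using ad_gen_in_lie[OF assms(2), of "(ad_gen i ^^ k) p" Q] by simp
  qed (use p in auto)
  moreover have "skew_coeff Q ?w ?p =
      ((\<Prod>j\<in>#b. Q i j) - 1) ^ k * skew_coeff Q w p * (\<Prod>m<k. \<Sum>l\<le>m. Q i i ^ l)"
    by (simp add: skew_coeff_def[of _ ?w] skew_list_append skew_list_funpow_ad_gen[OF i c] prod
        skew_list_scal_mult skew_list_gen_power scal_mult_scal)
  then have "skew_coeff Q ?w ?p \<noteq> 0"
    using braiding w(3) qint by simp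
  moreover have "set ?w \<subseteq> {1..n}" "mset ?w = b + replicate_mset k i"
    using w assms(2) by auto
  ultimately show ?thesis
    unfolding lie_degree_def by blast
qed

subsection \<open>Induced paths\<close>

abbreviation linked :: "(nat \<Rightarrow> nat \<Rightarrow> 'a::field) \<Rightarrow> nat \<Rightarrow> nat \<Rightarrow> bool" where
  "linked Q i j \<equiv> Q i j * Q j i \<noteq> 1"

text \<open>Chordlessness is imposed vertex by vertex: the head is linked to its successor and to
  nothing later. Empty lists are excluded so that \<open>hd\<close> and \<open>last\<close> are
  genuine end points.\<close>

fun induced_path :: "(nat \<Rightarrow> nat \<Rightarrow> 'a::field) \<Rightarrow> nat list \<Rightarrow> bool" where
  "induced_path Q [] \<longleftrightarrow> False"
| "induced_path Q [i] \<longleftrightarrow> True"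
| "induced_path Q (i # j # l) \<longleftrightarrow>
    i \<notin> set (j # l) \<and> linked Q i j \<and> (\<forall>k\<in>set l. \<not> linked Q i k) \<and> induced_path Q (j # l)"

lemma induced_path_suffix: "induced_path Q (u @ i # l) \<Longrightarrow> induced_path Q (i # l)"
proof (induction u)
  case (Cons j u)
  then show ?case by (cases "u @ i # l") auto
qed auto

lemma distinct_induced_path: "induced_path Q l \<Longrightarrow> distinct l"
  by (induction Q l rule: induced_path.induct) auto

definition path_between :: "nat \<Rightarrow> (nat \<Rightarrow> nat \<Rightarrow> 'a::field) \<Rightarrow> nat \<Rightarrow> nat \<Rightarrow> nat list \<Rightarrow> bool" where
  "path_between n Q i j l \<longleftrightarrow> induced_path Q l \<and> set l \<subseteq> {1..n} \<and> hd l = i \<and> last l = j"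

lemma path_between_hd_in_set: "path_between n Q i j l \<Longrightarrow> i \<in> set l"
  by (cases l) (auto simp: path_between_def)

text \<open>A chordless path is built backwards along a walk, with shortcuts taken whenever the new
  vertex already lies on the path or has several neighbours on it.\<close>

lemma ex_path_between:
  assumes "connected_braiding n Q" "i \<in> {1..n}" "j \<in> {1..n}"
  shows "\<exists>l. path_between n Q i j l"
proof -
  have "(i, j) \<in> {(k, l). k \<in> {1..n} \<and> l \<in> {1..n} \<and> k \<noteq> l \<and> linked Q k l}\<^sup>*"
    using assms by (simp add: connected_braiding_def)
  then show ?thesis
  proof (induction rule: converse_rtrancl_induct)
    case base
    show ?case
      using assms(3) by (intro exI[of _ "[j]"]) (simp add: path_between_def)
  next
    case (step i k)
    then obtain l where l: "induced_path Q l" "set l \<subseteq> {1..n}" "hd l = k" "last l = j"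
      by (auto simp: path_between_def)
    have k: "k \<in> set l"
      using l(1,3) by (cases l) auto
    show ?case
    proof (cases "i \<in> set l")
      case True
      then obtain u v where uv: "l = u @ i # v"
        by (meson split_list)
      have "induced_path Q (i # v)"
        using l(1) unfolding uv by (rule induced_path_suffix)
      then show ?thesis
        using l uv by (intro exI[of _ "i # v"]) (auto simp: path_between_def)
    next
      case False
      have "\<exists>x\<in>set l. linked Q i x"
        using k step.hyps(1) by blast
      \<comment> \<open>Jumping to the last neighbour of \<open>i\<close> on the path leaves no
        later neighbour, so putting \<open>i\<close> in front creates no chord.\<close>
      then obtain u x v where uxv: "l = u @ x # v" "linked Q i x" "\<forall>z\<in>set v. \<not> linked Q i z"
        using split_list_last_prop[of l "linked Q i"] by blast
      have "induced_path Q (x # v)"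
        using l(1) unfolding uxv(1) by (rule induced_path_suffix)
      then have "induced_path Q (i # x # v)"
        using False uxv by auto
      then show ?thesis
        using l uxv step.hyps(1) by (intro exI[of _ "i # x # v"]) (auto simp: path_between_def)
    qed
  qed
qed

text \<open>An end is a vertex with at most one neighbour in the induced subgraph. This depends on
  the support alone and not on the order of the list.\<close>

definition path_end :: "(nat \<Rightarrow> nat \<Rightarrow> 'a::field) \<Rightarrow> nat set \<Rightarrow> nat \<Rightarrow> bool" where
  "path_end Q S x \<longleftrightarrow> x \<in> S \<and>
    (\<forall>y\<in>S. \<forall>z\<in>S. y \<noteq> x \<and> z \<noteq> x \<and> linked Q x y \<and> linked Q x z \<longrightarrow> y = z)"

lemma path_end_iff: "induced_path Q l \<Longrightarrow> path_end Q (set l) x \<longleftrightarrow> x = hd l \<or> x = last l"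
proof (induction Q l rule: induced_path.induct)
  case (3 Q i j l)
  have ij: "linked Q i j" "linked Q j i" and il: "\<And>k. k \<in> set l \<Longrightarrow> \<not> linked Q i k \<and> \<not> linked Q k i"
    and i: "i \<notin> set (j # l)" and path: "induced_path Q (j # l)"
    using "3.prems" by (auto simp: mult.commute)
  consider "x = i" | "x = j" "l = []" | k v where "x = j" "l = k # v" | "x \<noteq> i" "x \<noteq> j"
    by (cases l) auto
  then show ?case
  proof cases
    case 1
    then show ?thesis using il by (auto simp: path_end_def)
  next
    case 2
    then show ?thesis using i by (auto simp: path_end_def)
  next
    case 3
    have jk: "linked Q j k" and ne: "k \<noteq> i" "k \<noteq> j" "i \<noteq> j" "j \<notin> set l"
      using path 3 i by auto
    \<comment> \<open>The second vertex is interior: it has the two distinct neighbours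
      \<open>i\<close> and \<open>k\<close>.\<close>
    have "\<not> path_end Q (set (i # j # l)) j"
    proof
      assume "path_end Q (set (i # j # l)) j"
      moreover have "i \<in> set (i # j # l)" "k \<in> set (i # j # l)"
        using 3 by auto
      ultimately have "i = k"
        unfolding path_end_def using jk ij(2) ne by blast
      with ne show False by simp
    qed
    moreover have "j \<noteq> last l"
      using 3 ne by (metis last_in_set list.distinct(1))
    ultimately show ?thesis
      using 3 ne by simp
  next
    case 4
    \<comment> \<open>The first vertex is not a neighbour of \<open>x\<close>, so removing it does
      not affect whether \<open>x\<close> is an end.\<close>
    have "path_end Q (set (i # j # l)) x \<longleftrightarrow> path_end Q (set (j # l)) x"
    proof (cases "x \<in> set l")
      case True
      then have "\<not> linked Q x i"
        using il by blast
      then show ?thesis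
        using True 4(1) unfolding path_end_def list.set by blast
    next
      case False
      then show ?thesis
        using 4 unfolding path_end_def list.set by blast
    qed
    then show ?thesis
      using "3.IH"[OF path] 4 by simp
  qed
qed (auto simp: path_end_def)

lemma ends_eq_if_same_support:
  assumes "path_between n Q i j l" "path_between n Q i' j' l'" "set l = set l'"
  shows "{i, j} = {i', j'}"
proof -
  have "{i, j} = {x. path_end Q (set l) x}" "{i', j'} = {x. path_end Q (set l') x}"
    using assms(1,2) path_end_iff[of Q l] path_end_iff[of Q l'] by (auto simp: path_between_def)
  then show ?thesis
    using assms(3) by simp
qed

lemma lie_degree_hd:
  assumes symmetric: "\<forall>i\<in>{1..n}. \<forall>j\<in>{1..n}. Q i j = Q j i"
    and path: "induced_path Q (i # j # l)" "set (i # j # l) \<subseteq> {1..n}"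
    and "lie_degree n Q (mset (j # l))"
    and "\<And>m. m < k \<Longrightarrow> (\<Sum>s\<le>m. Q i i ^ s) \<noteq> 0"
  shows "lie_degree n Q (mset (j # l) + replicate_mset k i)"
proof (rule lie_degree_ad)
  \<comment> \<open>The square of this product is \<open>Q i j * Q j i\<close>, the only factor different from \<open>1\<close>.\<close>
  have "(\<Prod>x\<in>#mset (j # l). Q i x) ^ 2 = (\<Prod>x\<in>#mset (j # l). Q i x * Q x i)"
    using symmetric path(2)
    by (auto simp: power2_eq_square prod_mset.distrib[symmetric] intro!: arg_cong[where f = prod_mset] image_mset_cong)
  also have "\<dots> = Q i j * Q j i"
    using path(1) by (auto intro!: prod_mset.neutral)
  finally show "(\<Prod>x\<in>#mset (j # l). Q i x) \<noteq> 1"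
    using path(1) by auto
qed (use assms in auto)

text \<open>Starting at the last vertex, one bracket with the preceding generator is taken for each
  further vertex.\<close>

lemma lie_degree_induced_path:
  assumes "\<forall>i\<in>{1..n}. \<forall>j\<in>{1..n}. Q i j = Q j i"
    and "induced_path Q l" "set l \<subseteq> {1..n}"
  shows "lie_degree n Q (mset l)"
  using assms
proof (induction Q l rule: induced_path.induct)
  case (3 Q i j l)
  then have "lie_degree n Q (mset (j # l))"
    by simp
  then show ?case
    using lie_degree_hd[OF "3.prems", of 1] by simp
qed (auto intro: lie_degree_single)

lemma power_neq_1_if_less_mult_order:
  assumes "ereal (real m) < mult_order x" "m > 0"
  shows "x ^ m \<noteq> 1"
proof
  assume "x ^ m = 1"
  then have "(LEAST k. k > 0 \<and> x ^ k = 1) \<le> m" "\<exists>k>0. x ^ k = 1"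
    using assms(2) by (auto intro: Least_le)
  then show False
    using assms(1) by (simp add: mult_order_def)
qed

text \<open>For q_ii = 1 the sum is the integer m+1, nonzero in characteristic zero, which matches
  the infinite value of \<open>diag_order\<close>. Otherwise it is a geometric sum.\<close>

lemma quantum_integer_nonzero:
  fixes Q :: "nat \<Rightarrow> nat \<Rightarrow> 'a::field_char_0"
  assumes "ereal (real (Suc m)) < diag_order Q i"
  shows "(\<Sum>s\<le>m. Q i i ^ s) \<noteq> 0"
proof (cases "Q i i = 1")
  case True
  then show ?thesis
    using of_nat_neq_0[of m, where 'a = 'a] by simp
next
  case False
  then have "Q i i ^ Suc m \<noteq> 1"
    using power_neq_1_if_less_mult_order[of "Suc m"] assms by (simp add: diag_order_def)
  then show ?thesis
    using one_diff_power_eq[of "Q i i" "Suc m"] by (auto simp: lessThan_Suc_atMost)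
qed

lemma lie_degree_path_between:
  fixes Q :: "nat \<Rightarrow> nat \<Rightarrow> 'a::field_char_0"
  assumes symmetric: "\<forall>i\<in>{1..n}. \<forall>j\<in>{1..n}. Q i j = Q j i"
    and path: "path_between n Q i j l" and k: "k = 0 \<or> i \<noteq> j \<and> ereal (real (k + 2)) \<le> diag_order Q i"
  shows "lie_degree n Q (mset l + replicate_mset k i)"
proof (cases "k = 0")
  case True
  then show ?thesis
    using lie_degree_induced_path[OF symmetric] path by (simp add: path_between_def)
next
  case False
  obtain j' v where l: "l = i # j' # v"
    using path k False by (cases "(Q, l)" rule: induced_path.cases) (auto simp: path_between_def)
  \<comment> \<open>The path already contains \<open>i\<close> once, so \<open>Suc k\<close>
    brackets with x_i are taken; hence the condition \<open>k + 2\<close> at most N_i.\<close>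
  have "ereal (real (Suc m)) < diag_order Q i" if "m < Suc k" for m
    using k False that by (auto intro: less_le_trans[of _ "ereal (real (k + 2))"])
  then have "lie_degree n Q (mset (j' # v) + replicate_mset (Suc k) i)"
    using path l
    by (intro lie_degree_hd[OF symmetric] lie_degree_induced_path[OF symmetric] quantum_integer_nonzero)
      (auto simp: path_between_def)
  then show ?thesis
    by (simp add: l)
qed

subsection \<open>Counting degrees\<close>

lemma sum_ordered_pairs: "(\<Sum>i=1..n. \<Sum>j=1..n. if i \<le> j then 1 else 0) = n + (n choose 2)"
proof (induction n)
  case (Suc n)
  have "(\<Sum>i=1..Suc n. \<Sum>j=1..Suc n. if i \<le> j then 1 else 0 :: nat) =
    (\<Sum>i=1..n. (\<Sum>j=1..n. if i \<le> j then 1 else 0) + 1) + 1"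
    by simp
  then show ?case
    using Suc by (simp add: sum_Suc numeral_2_eq_2)
qed simp

text \<open>The numbers \<open>M i\<close> are natural lower bounds for the orders, so that finite
  and infinite orders are covered by one count.\<close>

lemma nichols_lie_dim_ge:
  fixes Q :: "nat \<Rightarrow> nat \<Rightarrow> 'a::field_char_0"
  assumes connected: "connected_braiding n Q"
    and symmetric: "\<forall>i\<in>{1..n}. \<forall>j\<in>{1..n}. Q i j = Q j i"
    and M: "\<And>i. i \<in> {1..n} \<Longrightarrow> ereal (real (M i)) \<le> diag_order Q i"
  shows "ereal (real (n + (n choose 2) + (n - 1) * (\<Sum>i=1..n. M i - 2))) \<le> nichols_lie_dim n Q"
proof -
  obtain P where P: "\<And>i j. i \<in> {1..n} \<Longrightarrow> j \<in> {1..n} \<Longrightarrow> path_between n Q i j (P i j)"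
    using ex_path_between[OF connected] by metis
  \<comment> \<open>The value \<open>k = 0\<close> is allowed only for \<open>i\<close> at most
    \<open>j\<close>, since the paths for (i,j) and (j,i) may have the same support and would then
    give the same degree.\<close>
  define K where "K i j = (if i = j then {0} else if i < j then {0..M i - 2} else {1..M i - 2})" for i j
  define T where "T = (SIGMA ij:{1..n} \<times> {1..n}. K (fst ij) (snd ij))"
  define f where "f = (\<lambda>((i, j), k). mset (P i j) + replicate_mset k i)"
  have K: "k = 0 \<or> i \<noteq> j \<and> k + 2 \<le> M i" "k = 0 \<Longrightarrow> i \<le> j" if "k \<in> K i j" for i j k
    using that by (auto simp: K_def split: if_splits)
  \<comment> \<open>The support of a degree gives the unordered pair of ends, and the excess over
    multiplicity one gives \<open>i\<close> and \<open>k\<close> if \<open>k\<close> is positive.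
    For \<open>k = 0\<close> the ordering of the ends decides.\<close>
  have "inj_on f T"
  proof (rule inj_onI)
    fix s t assume s: "s \<in> T" and t: "t \<in> T" and eq: "f s = f t"
    obtain i j k where s': "s = ((i, j), k)" by (metis prod.exhaust)
    obtain i' j' k' where t': "t = ((i', j'), k')" by (metis prod.exhaust)
    have ij: "path_between n Q i j (P i j)" "k \<in> K i j" and ij': "path_between n Q i' j' (P i' j')" "k' \<in> K i' j'"
      using s t P by (auto simp: T_def s' t')
    have mem: "i \<in> set (P i j)" "i' \<in> set (P i' j')"
      using ij(1) ij'(1) by (auto dest: path_between_hd_in_set)
    have distinct: "distinct (P i j)" "distinct (P i' j')"
      using ij(1) ij'(1) unfolding path_between_def by (blast dest: distinct_induced_path)+
    have supp: "set_mset (f ((i, j), k)) = set (P i j)" "set_mset (f ((i', j'), k')) = set (P i' j')"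
      using mem by (auto simp: f_def)
    then have set: "set (P i j) = set (P i' j')"
      using eq by (simp add: s' t')
    then have ends: "{i, j} = {i', j'}"
      using ends_eq_if_same_support ij(1) ij'(1) by blast
    have count: "count (f ((i, j), k)) x = (if x \<in> set (P i j) then 1 else 0) + (if x = i then k else 0)"
      "count (f ((i', j'), k')) x = (if x \<in> set (P i' j') then 1 else 0) + (if x = i' then k' else 0)" for x
      using distinct by (auto simp: f_def distinct_count_atmost_1)
    then have k: "(if x = i then k else 0) = (if x = i' then k' else 0)" for x
      using count[of x] eq set by (simp add: s' t')
    show "s = t"
    proof (cases "i = i'")
      case True
      then show ?thesis
        using k[of i] ends by (auto simp: s' t' doubleton_eq_iff)
    next
      case False
      then have "k = 0" "k' = 0"
        using k[of i] k[of i'] by auto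
      then have "i \<le> j" "i' \<le> j'"
        using K ij(2) ij'(2) by auto
      then show ?thesis
        using False ends by (auto simp: doubleton_eq_iff)
    qed
  qed
  then have "card (f ` T) = card T"
    by (rule card_image)
  also have "card T = (\<Sum>ij\<in>{1..n} \<times> {1..n}. card (K (fst ij) (snd ij)))"
    unfolding T_def by (rule card_SigmaI) (auto simp: K_def)
  also have "\<dots> = (\<Sum>i=1..n. \<Sum>j=1..n. card (K i j))"
    by (simp add: sum.cartesian_product case_prod_beta)
  also have "\<dots> = (\<Sum>i=1..n. \<Sum>j=1..n. (if i \<le> j then 1 else 0) + (if j = i then 0 else M i - 2))"
    by (intro sum.cong) (auto simp: K_def)
  also have "\<dots> = n + (n choose 2) + (\<Sum>i=1..n. \<Sum>j=1..n. if j = i then 0 else M i - 2)"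
    by (simp only: sum.distrib sum_ordered_pairs)
  also have "(\<Sum>i=1..n. \<Sum>j=1..n. if j = i then 0 else M i - 2) = (\<Sum>i=1..n. (n - 1) * (M i - 2))"
    by (intro sum.cong) (auto simp: sum.If_cases Collect_neg_eq[symmetric] Diff_eq[symmetric] simp flip: Compl_eq)
  finally have "card (f ` T) = n + (n choose 2) + (n - 1) * (\<Sum>i=1..n. M i - 2)"
    by (simp add: sum_distrib_left)
  moreover have "ereal (real (card (f ` T))) \<le> nichols_lie_dim n Q"
  proof (rule card_le_nichols_lie_dim)
    show "finite (f ` T)"
      by (auto simp: T_def K_def)
    fix b assume "b \<in> f ` T"
    then obtain i j k where b: "b = mset (P i j) + replicate_mset k i" "i \<in> {1..n}" "j \<in> {1..n}" "k \<in> K i j"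
      by (auto simp: f_def T_def)
    have "k = 0 \<or> i \<noteq> j \<and> ereal (real (k + 2)) \<le> diag_order Q i"
      using K(1)[OF b(4)] M[OF b(2)] by (metis ereal_less_eq(3) of_nat_mono order_trans)
    then show "lie_degree n Q b"
      unfolding b(1) using lie_degree_path_between[OF symmetric P[OF b(2,3)]] by blast
  qed
  ultimately show ?thesis
    by metis
qed

text \<open>Order 1 cannot occur, because \<open>diag_order\<close> is infinite for q_ii = 1; order
  2 is excluded once q_ii squared differs from 1.\<close>

lemma diag_order_finite:
  assumes "diag_order Q i \<noteq> \<infinity>"
  obtains m where "diag_order Q i = ereal (real m)" "m \<ge> 2" "Q i i ^ 2 \<noteq> 1 \<Longrightarrow> m \<ge> 3"
proof -
  have ne: "Q i i \<noteq> 1" and ex: "\<exists>k>0. Q i i ^ k = 1"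
    using assms by (auto simp: diag_order_def mult_order_def split: if_splits)
  define m where "m = (LEAST k. k > 0 \<and> Q i i ^ k = 1)"
  have m: "m > 0" "Q i i ^ m = 1"
    using LeastI_ex[OF ex] by (auto simp: m_def)
  then have "m \<noteq> 1"
    using ne by auto
  with m have "m \<ge> 2" by simp
  moreover have "m \<ge> 3" if "Q i i ^ 2 \<noteq> 1"
    using m that \<open>m \<ge> 2\<close> by (cases "m = 2") auto
  ultimately show ?thesis
    using that[of m] ne ex by (auto simp: diag_order_def mult_order_def m_def)
qed

text \<open>An infinite order forces infinite dimension and settles every bound. Otherwise all
  comparisons become real arithmetic in d_k = N_k - 2.\<close>

lemma nichols_lie_dim_cases:
  fixes Q :: "nat \<Rightarrow> nat \<Rightarrow> 'a::field_char_0"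
  assumes n: "n > 1"
    and connected: "connected_braiding n Q"
    and symmetric: "\<forall>i\<in>{1..n}. \<forall>j\<in>{1..n}. Q i j = Q j i"
  obtains "nichols_lie_dim n Q = \<infinity>"
  | d where "\<And>k. k \<in> {1..n} \<Longrightarrow> diag_order Q k = ereal (d k + 2)" "\<And>k. k \<in> {1..n} \<Longrightarrow> d k \<ge> 0"
      "\<And>k. k \<in> {1..n} \<Longrightarrow> Q k k ^ 2 \<noteq> 1 \<Longrightarrow> d k \<ge> 1"
      "nichols_lie_dim n Q \<ge> ereal (real n + real (n choose 2) + (real n - 1) * (\<Sum>k=1..n. d k))"
proof (cases "\<exists>i\<in>{1..n}. diag_order Q i = \<infinity>")
  case True
  then obtain i where i: "i \<in> {1..n}" "diag_order Q i = \<infinity>"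
    by blast
  have "0 \<le> diag_order Q k" for k
    by (simp add: diag_order_def mult_order_def)
  have "ereal (real B) \<le> nichols_lie_dim n Q" for B
  proof -
    \<comment> \<open>At the vertex of infinite order any natural number is a lower bound;
      \<open>B + 2\<close> makes the excess exactly \<open>B\<close>, with truncated zeros
      elsewhere.\<close>
    let ?M = "\<lambda>k. if k = i then B + 2 else 0"
    have "(\<Sum>k=1..n. ?M k - 2) = (\<Sum>k=1..n. if k = i then B else 0)"
      by (intro sum.cong) auto
    also have "\<dots> = B"
      using i(1) by simp
    finally have "B \<le> n + (n choose 2) + (n - 1) * (\<Sum>k=1..n. ?M k - 2)"
      using n by (cases "n - 1") auto
    then have "ereal (real B) \<le> ereal (real (n + (n choose 2) + (n - 1) * (\<Sum>k=1..n. ?M k - 2)))"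
      by (simp only: ereal_less_eq of_nat_le_iff)
    also have "\<dots> \<le> nichols_lie_dim n Q"
      using i \<open>\<And>k. 0 \<le> diag_order Q k\<close> by (intro nichols_lie_dim_ge[OF connected symmetric]) (auto simp: zero_ereal_def)
    finally show ?thesis .
  qed
  then have "nichols_lie_dim n Q = \<infinity>"
    by (intro ereal_top) (meson ereal_less_eq(3) order_trans real_arch_simple)
  then show ?thesis by fact
next
  case False
  then have "\<forall>i\<in>{1..n}. \<exists>m. diag_order Q i = ereal (real m) \<and> m \<ge> 2 \<and> (Q i i ^ 2 \<noteq> 1 \<longrightarrow> m \<ge> 3)"
    by (metis diag_order_finite)
  then obtain m where m: "\<And>i. i \<in> {1..n} \<Longrightarrow> diag_order Q i = ereal (real (m i)) \<and> m i \<ge> 2 \<and> (Q i i ^ 2 \<noteq> 1 \<longrightarrow> m i \<ge> 3)"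
    by metis
  have "real (\<Sum>k=1..n. m k - 2) = (\<Sum>k=1..n. real (m k) - 2)"
    unfolding of_nat_sum using m by (intro sum.cong) (auto simp: of_nat_diff)
  then have "real n + real (n choose 2) + (real n - 1) * (\<Sum>k=1..n. real (m k) - 2)
      = real (n + (n choose 2) + (n - 1) * (\<Sum>i=1..n. m i - 2))"
    using n by (simp add: of_nat_diff)
  moreover have "ereal (real (n + (n choose 2) + (n - 1) * (\<Sum>i=1..n. m i - 2))) \<le> nichols_lie_dim n Q"
    using m by (intro nichols_lie_dim_ge[OF connected symmetric]) auto
  ultimately have "ereal (real n + real (n choose 2) + (real n - 1) * (\<Sum>k=1..n. real (m k) - 2)) \<le> nichols_lie_dim n Q"
    by simp
  moreover have "diag_order Q k = ereal (real (m k) - 2 + 2)" "0 \<le> real (m k) - 2"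
    "Q k k ^ 2 \<noteq> 1 \<Longrightarrow> 1 \<le> real (m k) - 2" if "k \<in> {1..n}" for k
    using m[OF that] by auto
  ultimately show ?thesis
    using that(2)[of "\<lambda>k. real (m k) - 2"] by blast
qed

section \<open>Inequalities for the comparison of bounds\<close>

lemma two_mult_choose_two: "2 * real (n choose 2) = real n * (real n - 1)"
  by (induction n) (simp_all add: numeral_2_eq_2 algebra_simps)

lemma mult_order_eq_4:
  assumes "q ^ 4 = 1" "q ^ 2 \<noteq> 1"
  shows "mult_order q = 4"
proof -
  have "(LEAST k. k > 0 \<and> q ^ k = 1) = 4"
  proof (rule Least_equality)
    fix k assume k: "0 < k \<and> q ^ k = 1"
    show "4 \<le> k"
    proof (rule ccontr)
      assume "\<not> 4 \<le> k"
      then have "k = 1 \<or> k = 2 \<or> k = 3"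
        using k by auto
      \<comment> \<open>This excludes order 3, which would force q = q^4 = 1.\<close>
      moreover have "q ^ 4 = q ^ 3 * q"
        by (simp add: eval_nat_numeral)
      ultimately show False
        using k assms by auto
    qed
  qed (use assms in auto)
  moreover have "\<exists>k>0. q ^ k = 1"
    using assms(1) by (intro exI[of _ 4]) simp
  ultimately show ?thesis
    by (simp add: mult_order_def)
qed

text \<open>With S the full sum, the left-hand sums are 2 S - d_1 - d_n, so the claim is (n-1)(n-2)
  \<le> (n-3) S + d_1 + d_n. It follows from S \<ge> n and (n-3) n + 2 = (n-1)(n-2);
  \<open>n = 2\<close> is separate because n-3 is negative there.\<close>

lemma sum_ends_le:
  fixes d :: "nat \<Rightarrow> real"
  assumes "n > 1" and d: "\<And>k. k \<in> {1..n} \<Longrightarrow> d k \<ge> 1"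
  shows "(\<Sum>k=1..n-1. d k) + (\<Sum>k=2..n. d k) + (real n - 1) * (real n - 2) \<le> (real n - 1) * (\<Sum>k=1..n. d k)"
proof -
  have split: "(\<Sum>k=1..n. d k) = (\<Sum>k=1..n-1. d k) + d n" "(\<Sum>k=1..n. d k) = d 1 + (\<Sum>k=2..n. d k)"
    using assms(1) sum.cl_ivl_Suc[of d 1 "n - 1"] sum.atLeast_Suc_atMost[of 1 n d]
    by (simp_all add: numeral_2_eq_2)
  show ?thesis
  proof (cases "n = 2")
    case True
    then show ?thesis using split by (simp add: numeral_2_eq_2)
  next
    case False
    have "real n \<le> (\<Sum>k=1..n. d k)"
      using sum_mono[of "{1..n}" "\<lambda>_. 1" d] d by simp
    then have "(real n - 3) * real n \<le> (real n - 3) * (\<Sum>k=1..n. d k)"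
      using False assms(1) by (intro mult_left_mono) auto
    then show ?thesis
      using split d[of 1] d[of n] assms(1) by (simp add: algebra_simps)
  qed
qed

text \<open>The difference of the two sides is (n-1)(n-2)(c-1).\<close>

lemma const_sum_le:
  fixes d :: "nat \<Rightarrow> real"
  assumes "n > 1" "c \<ge> 1" and d: "\<And>k. k \<in> {1..n} \<Longrightarrow> d k = c"
  shows "2 * (real n - 1) * c + (real n - 1) * (real n - 2) \<le> (real n - 1) * (\<Sum>k=1..n. d k)"
proof -
  have "(\<Sum>k=1..n. d k) = real n * c"
    using d by simp
  moreover have "0 \<le> (real n - 1) * (real n - 2) * (c - 1)"
    using assms by simp
  ultimately show ?thesis
    by (simp add: algebra_simps)
qed

section \<open>Comparison with the bound of each Dynkin type\<close>

theorem theorem4p5: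
  fixes Q :: "nat \<Rightarrow> nat \<Rightarrow> 'a::field_char_0"
    and a :: "nat \<Rightarrow> nat \<Rightarrow> int"
    and n :: nat
    and q :: 'a
    and N :: ereal
    and N' :: "nat \<Rightarrow> ereal"
  assumes n: "n > 1"
    and nonzero: "\<forall>i\<in>{1..n}. \<forall>j\<in>{1..n}. Q i j \<noteq> 0"
    and connected: "connected_braiding n Q"
    and cartan: "finite_cartan_type n Q a"
    and symmetric: "\<forall>i\<in>{1..n}. \<forall>j\<in>{1..n}. Q i j = Q j i"
    and q: "q \<noteq> 1"
    and N: "N = mult_order (Q 1 1)"
    and N': "\<forall>k\<in>{1..n}. N' k = diag_order Q k"
  shows
   \<comment> \<open>(i)\<close>
   "(has_dynkin_type Type_A n a \<and>
      (\<forall>i\<in>{1..n}. Q i i = q) \<and>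
      (\<forall>i\<in>{1..<n}. Q i (i + 1) * Q (i + 1) i = inverse q) \<and>
      unlinked_outside n Q (chain_edges n) \<longrightarrow>
      (q ^ 2 = 1 \<longrightarrow> nichols_lie_dim n Q \<ge> ereal (real (n choose 2) + real n)) \<and>
      (q ^ 2 \<noteq> 1 \<longrightarrow> nichols_lie_dim n Q \<ge>
        ereal (2 * (real n - 1)) * (N - 2) + ereal (3 * real (n choose 2) - real n + 2))) \<and>
    (has_dynkin_type Type_B n a \<and> n > 2 \<and>
      (\<forall>i\<in>{1..n-1}. Q i i = q ^ 2) \<and> Q n n = q \<and>
      (\<forall>i\<in>{1..<n}. Q i (i + 1) * Q (i + 1) i = inverse (q ^ 2)) \<and>
      unlinked_outside n Q (chain_edges n) \<longrightarrow>
      (q ^ 4 = 1 \<and> q ^ 2 \<noteq> 1 \<longrightarrow> nichols_lie_dim n Q \<ge>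
        (N' n - 2) + ereal (real (n choose 2) + real n)) \<and>
      (q ^ 4 \<noteq> 1 \<longrightarrow> nichols_lie_dim n Q \<ge>
        (\<Sum>k=1..n-1. N' k - 2) + (\<Sum>k=2..n. N' k - 2)
          + ereal (3 * real (n choose 2) - 2 * (real n - 1) + real n))) \<and>
    (has_dynkin_type Type_C n a \<and> n > 2 \<and>
      (\<forall>i\<in>{1..n-1}. Q i i = q) \<and> Q n n = q ^ 2 \<and>
      (\<forall>i\<in>{1..n-2}. Q i (i + 1) * Q (i + 1) i = inverse q) \<and>
      Q (n - 1) n * Q n (n - 1) = inverse (q ^ 2) \<and>
      unlinked_outside n Q (chain_edges n) \<longrightarrow>
      (q ^ 4 = 1 \<and> q ^ 2 \<noteq> 1 \<longrightarrow> nichols_lie_dim n Q \<ge>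
        (\<Sum>k=1..n-2. N' k - 2) + (\<Sum>k=2..n-1. N' k - 2)
          + ereal (3 * real ((n - 1) choose 2) - 2 * (real n - 2) + (real n - 1))
          + ((N' (n - 1) - 2) + ereal ((real n - 1) + (real n - 2) + 1))) \<and>
      (q ^ 4 \<noteq> 1 \<longrightarrow> nichols_lie_dim n Q \<ge>
        (\<Sum>k=1..n-1. N' k - 2) + (\<Sum>k=2..n. N' k - 2)
          + ereal (3 * real (n choose 2) - 2 * (real n - 1) + real n))) \<and>
    (has_dynkin_type Type_D n a \<and> n > 3 \<and>
      (\<forall>i\<in>{1..n}. Q i i = q) \<and>
      (\<forall>i\<in>{1..n-2}. Q i (i + 1) * Q (i + 1) i = inverse q) \<and>
      Q (n - 2) n * Q n (n - 2) = inverse q \<and>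
      unlinked_outside n Q (D_edges n) \<longrightarrow>
      (q ^ 2 = 1 \<longrightarrow> nichols_lie_dim n Q \<ge>
        ereal (real ((n - 1) choose 2) + 2 * real n - 1)) \<and>
      (q ^ 2 \<noteq> 1 \<longrightarrow> nichols_lie_dim n Q \<ge>
        ereal (2 * (real n - 2)) * (N - 2)
          + ereal (3 * real ((n - 1) choose 2) + 2 * real n) + 2 * N - 5)) \<and>
    (has_dynkin_type Type_E n a \<and> n = 8 \<and>
      (\<forall>i\<in>{1..8}. Q i i = q) \<and>
      (\<forall>i\<in>{1..6}. Q i (i + 1) * Q (i + 1) i = inverse q) \<and>
      Q 5 8 * Q 8 5 = inverse q \<and>
      unlinked_outside n Q (E_edges 8) \<longrightarrow>
      (q ^ 2 = 1 \<longrightarrow> nichols_lie_dim n Q \<ge> ereal (real (7 choose 2) + 15)) \<and>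
      (q ^ 2 \<noteq> 1 \<longrightarrow> nichols_lie_dim n Q \<ge> 14 * N + 50)) \<and>
    (has_dynkin_type Type_E n a \<and> n = 7 \<and>
      (\<forall>i\<in>{1..7}. Q i i = q) \<and>
      (\<forall>i\<in>{1..5}. Q i (i + 1) * Q (i + 1) i = inverse q) \<and>
      Q 4 7 * Q 7 4 = inverse q \<and>
      unlinked_outside n Q (E_edges 7) \<longrightarrow>
      (q ^ 2 = 1 \<longrightarrow> nichols_lie_dim n Q \<ge> ereal (real (6 choose 2) + 13)) \<and>
      (q ^ 2 \<noteq> 1 \<longrightarrow> nichols_lie_dim n Q \<ge> 12 * N + 34)) \<and>
    (has_dynkin_type Type_E n a \<and> n = 6 \<and>
      (\<forall>i\<in>{1..6}. Q i i = q) \<and>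
      (\<forall>i\<in>{1..4}. Q i (i + 1) * Q (i + 1) i = inverse q) \<and>
      Q 3 6 * Q 6 3 = inverse q \<and>
      unlinked_outside n Q (E_edges 6) \<longrightarrow>
      (q ^ 2 = 1 \<longrightarrow> nichols_lie_dim n Q \<ge> ereal (real (5 choose 2) + 6 + 5)) \<and>
      (q ^ 2 \<noteq> 1 \<longrightarrow> nichols_lie_dim n Q \<ge> 10 * N + 21)) \<and>
    (has_dynkin_type Type_F4 n a \<and> n = 4 \<and>
      Q 1 1 = q ^ 2 \<and> Q 2 2 = q ^ 2 \<and> Q 3 3 = q \<and> Q 4 4 = q \<and>
      Q 1 2 * Q 2 1 = inverse (q ^ 2) \<and> Q 2 3 * Q 3 2 = inverse (q ^ 2) \<and>
      Q 3 4 * Q 4 3 = inverse q \<and>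
      unlinked_outside n Q (chain_edges 4) \<longrightarrow>
      (q ^ 4 = 1 \<and> q ^ 2 \<noteq> 1 \<longrightarrow> nichols_lie_dim n Q \<ge>
        2 * (N' 3 - 2) + (N' 4 - 2) + ereal (real (4 choose 2) + 4 + 4)) \<and>
      (q ^ 4 \<noteq> 1 \<longrightarrow> nichols_lie_dim n Q \<ge>
        (\<Sum>k=1..3. N' k - 2) + (\<Sum>k=2..4. N' k - 2)
          + ereal (3 * real (4 choose 2) - 2 * 3 + 4))) \<and>
    (has_dynkin_type Type_G2 n a \<and> n = 2 \<and>
      Q 1 1 = q \<and> Q 2 2 = q ^ 3 \<and> Q 1 2 * Q 2 1 = inverse (q ^ 3) \<longrightarrow>
      (q ^ 2 = 1 \<longrightarrow> nichols_lie_dim n Q \<ge> 3) \<and>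
      (q ^ 2 \<noteq> 1 \<longrightarrow> nichols_lie_dim n Q \<ge> (N' 1 - 2) + (N' 2 - 2) + 3))"
proof (rule nichols_lie_dim_cases[OF n connected symmetric])
  assume "nichols_lie_dim n Q = \<infinity>"
  then have "x \<le> nichols_lie_dim n Q" for x
    by simp
  then show ?thesis
    by (intro conjI impI)
next
  fix d
  assume order: "\<And>k. k \<in> {1..n} \<Longrightarrow> diag_order Q k = ereal (d k + 2)"
    and d0: "\<And>k. k \<in> {1..n} \<Longrightarrow> d k \<ge> 0"
    and d1: "\<And>k. k \<in> {1..n} \<Longrightarrow> Q k k ^ 2 \<noteq> 1 \<Longrightarrow> d k \<ge> 1"
    and dim: "ereal (real n + real (n choose 2) + (real n - 1) * (\<Sum>k=1..n. d k)) \<le> nichols_lie_dim n Q"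
  have ge: "ereal x \<le> nichols_lie_dim n Q"
    if "x \<le> real n + real (n choose 2) + (real n - 1) * (\<Sum>k=1..n. d k)" for x
    using that dim by (meson ereal_less_eq(3) order_trans)
  have "0 \<le> (\<Sum>k=1..n. d k)"
    using d0 by (intro sum_nonneg) auto
  then have sum_le: "(\<Sum>k=1..n. d k) \<le> (real n - 1) * (\<Sum>k=1..n. d k)"
    and sum0: "0 \<le> (real n - 1) * (\<Sum>k=1..n. d k)"
    using n mult_right_mono[of 1 "real n - 1" "\<Sum>k=1..n. d k"] by auto
  have N'_eq: "N' k = ereal (d k + 2)" if "k \<in> {1..n}" for k
    using that N' order by simp
  have "(\<Sum>k=a..b. N' k - ereal 2) = (\<Sum>k=a..b. ereal (d k))" if "1 \<le> a" "b \<le> n" for a b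
    using that by (intro sum.cong) (auto simp: N'_eq)
  then have sumN': "(\<Sum>k=a..b. N' k - ereal 2) = ereal (\<Sum>k=a..b. d k)" if "1 \<le> a" "b \<le> n" for a b
    using that by (simp add: sum_ereal)
  \<comment> \<open>\<open>N\<close> is the plain multiplicative order; it agrees with
    \<open>diag_order\<close> away from q_11 = 1.\<close>
  have N_eq: "N = ereal (d 1 + 2)" if "Q 1 1 \<noteq> 1"
    using that N order[of 1] n by (simp add: diag_order_def)
  have const: "d k = d 1" if "\<forall>i\<in>{1..n}. Q i i = q" "k \<in> {1..n}" for k
  proof -
    have "Q k k = q" "Q 1 1 = q"
      using that n by auto
    then have "diag_order Q k = diag_order Q 1"
      unfolding diag_order_def by metis
    then show ?thesis
      using order[of k] order[of 1] that(2) n by simp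
  qed
  have const_bound: "2 * (real n - 1) * d 1 + (real n - 1) * (real n - 2) \<le> (real n - 1) * (\<Sum>k=1..n. d k)"
    "Q 1 1 = q" if "\<forall>i\<in>{1..n}. Q i i = q" "q ^ 2 \<noteq> 1"
    using const_sum_le[OF n _ const[OF that(1)]] d1[of 1] that n by auto
  note choose = two_mult_choose_two[of n]
  \<comment> \<open>For q^2 = 1 this is already the value listed in types A, D, E and G_2.\<close>
  have small: "ereal (real n + real (n choose 2)) \<le> nichols_lie_dim n Q"
    using sum0 by (intro ge) simp
  \<comment> \<open>With d_1 = N - 2 this is exactly the value listed in types A, D and E for q^2
    different from 1.\<close>
  have large: "ereal (real n + real (n choose 2) + (2 * (real n - 1) * d 1 + (real n - 1) * (real n - 2)))
      \<le> nichols_lie_dim n Q" if "\<forall>i\<in>{1..n}. Q i i = q" "q ^ 2 \<noteq> 1"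
    using const_bound[OF that] by (intro ge) simp
  \<comment> \<open>In types B, C and F_4 the diagonal entries are q or q^2, and this makes every
    d_k at least 1.\<close>
  have q4: "(q ^ 2) ^ 2 \<noteq> 1" "q ^ 2 \<noteq> 1" if "q ^ 4 \<noteq> 1"
    using that by (auto simp flip: power_mult) (metis mult_2 numeral_Bit0 power_add power_one)
  show ?thesis
  proof (intro conjI, goal_cases)
    case 1
    show ?case
    proof (intro impI conjI; elim conjE)
      assume "q ^ 2 = 1"
      show "ereal (real (n choose 2) + real n) \<le> nichols_lie_dim n Q"
        using small by (simp add: add.commute)
    next
      assume "\<forall>i\<in>{1..n}. Q i i = q" "q ^ 2 \<noteq> 1"
      from const_bound[OF this] choose show "ereal (2 * (real n - 1)) * (N - 2) + ereal (3 * real (n choose 2) - real n + 2) \<le> nichols_lie_dim n Q"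
        using N_eq q by (auto intro!: ge simp: algebra_simps)
    qed
  next
    case 2
    show ?case
    proof (intro impI conjI; elim conjE)
      assume "2 < n"
      have "d n \<le> (\<Sum>k=1..n. d k)"
        using n d0 by (intro member_le_sum) auto
      also note sum_le
      finally show "(N' n - 2) + ereal (real (n choose 2) + real n) \<le> nichols_lie_dim n Q"
        using n by (auto intro!: ge simp: N'_eq)
    next
      assume "\<forall>i\<in>{1..n-1}. Q i i = q ^ 2" "Q n n = q" "q ^ 4 \<noteq> 1"
      then have "d k \<ge> 1" if "k \<in> {1..n}" for k
        using d1[of k] that q4 by (cases "k = n") auto
      from sum_ends_le[of n d, OF n this] choose show "(\<Sum>k=1..n-1. N' k - 2) + (\<Sum>k=2..n. N' k - 2)
          + ereal (3 * real (n choose 2) - 2 * (real n - 1) + real n) \<le> nichols_lie_dim n Q"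
        by (auto intro!: ge simp: sumN' algebra_simps)
    qed
  next
    case 3
    show ?case
    proof (intro impI conjI; elim conjE)
      assume hyp: "2 < n" "\<forall>i\<in>{1..n-1}. Q i i = q" "q ^ 2 \<noteq> 1"
      \<comment> \<open>For q^4 = 1 the entry q_nn = q^2 has square 1, so only d_n \<ge> 0 is known
        there. The inequality for sums without end terms is applied to the first \<open>m\<close>
        vertices.\<close>
      define m where "m = n - 1"
      have m: "n = Suc m" "m > 1"
        using hyp(1) by (auto simp: m_def)
      have dm: "d k \<ge> 1" if "k \<in> {1..m}" for k
        using d1[of k] that hyp by (auto simp: m_def)
      \<comment> \<open>That inequality uses m-1 of the m copies of the sum over these vertices. The
        last copy covers d_m and the missing constant m-1.\<close>
      have "(\<Sum>k=1..m-1. 1) \<le> (\<Sum>k=1..m-1. d k)"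
        by (intro sum_mono dm) auto
      then have "real m - 1 \<le> (\<Sum>k=1..m-1. d k)"
        using m by (simp add: of_nat_diff)
      moreover have "(\<Sum>k=1..m. d k) = (\<Sum>k=1..m-1. d k) + d m"
        using sum.cl_ivl_Suc[of d 1 "m - 1"] m by simp
      moreover have "real m * (\<Sum>k=1..m. d k) \<le> real m * (\<Sum>k=1..n. d k)"
        using d0[of n] m by (intro mult_left_mono) auto
      moreover have eq: "n - 2 = m - 1" "n - 1 = m" "real n = real m + 1"
        using m by simp_all
      ultimately have "(\<Sum>k=1..m-1. d k) + (\<Sum>k=2..m. d k) + (3 * real (m choose 2) + real m + d m + 2)
          \<le> real n + real (n choose 2) + (real n - 1) * (\<Sum>k=1..n. d k)"
        using sum_ends_le[of m d, OF m(2) dm] choose two_mult_choose_two[of m]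
        by (simp add: algebra_simps)
      from ge[OF this] show "(\<Sum>k=1..n-2. N' k - 2) + (\<Sum>k=2..n-1. N' k - 2)
          + ereal (3 * real ((n - 1) choose 2) - 2 * (real n - 2) + (real n - 1))
          + ((N' (n - 1) - 2) + ereal ((real n - 1) + (real n - 2) + 1)) \<le> nichols_lie_dim n Q"
        using m(2) eq by (simp add: sumN' N'_eq eq algebra_simps)
    next
      assume "\<forall>i\<in>{1..n-1}. Q i i = q" "Q n n = q ^ 2" "q ^ 4 \<noteq> 1"
      then have "d k \<ge> 1" if "k \<in> {1..n}" for k
        using d1[of k] that q4 by (cases "k = n") auto
      from sum_ends_le[of n d, OF n this] choose show "(\<Sum>k=1..n-1. N' k - 2) + (\<Sum>k=2..n. N' k - 2)
          + ereal (3 * real (n choose 2) - 2 * (real n - 1) + real n) \<le> nichols_lie_dim n Q"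
        by (auto intro!: ge simp: sumN' algebra_simps)
    qed
  next
    case 4
    have choose1: "2 * real ((n - 1) choose 2) = (real n - 1) * (real n - 2)"
      using n two_mult_choose_two[of "n - 1"] by (simp add: of_nat_diff)
    show ?case
    proof (intro impI conjI; elim conjE)
      show "ereal (real ((n - 1) choose 2) + 2 * real n - 1) \<le> nichols_lie_dim n Q"
        using sum0 choose choose1 by (intro ge) (simp add: algebra_simps)
    next
      assume "\<forall>i\<in>{1..n}. Q i i = q" "q ^ 2 \<noteq> 1"
      from const_bound[OF this] choose show "ereal (2 * (real n - 2)) * (N - 2)
          + ereal (3 * real ((n - 1) choose 2) + 2 * real n) + 2 * N - 5 \<le> nichols_lie_dim n Q"
        using N_eq q choose1 by (auto intro!: ge simp: algebra_simps)
    qed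
  next
    case 5
    show ?case
    proof (intro impI conjI; elim conjE)
      assume "n = 8"
      then show "ereal (real (7 choose 2) + 15) \<le> nichols_lie_dim n Q"
        using small two_mult_choose_two[of 8] two_mult_choose_two[of 7] by simp
    next
      assume "n = 8" "\<forall>i\<in>{1..8}. Q i i = q" "q ^ 2 \<noteq> 1"
      then show "14 * N + 50 \<le> nichols_lie_dim n Q"
        using large N_eq q two_mult_choose_two[of 8] by simp
    qed
  next
    case 6
    show ?case
    proof (intro impI conjI; elim conjE)
      assume "n = 7"
      then show "ereal (real (6 choose 2) + 13) \<le> nichols_lie_dim n Q"
        using small two_mult_choose_two[of 7] two_mult_choose_two[of 6] by simp
    next
      assume "n = 7" "\<forall>i\<in>{1..7}. Q i i = q" "q ^ 2 \<noteq> 1"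
      then show "12 * N + 34 \<le> nichols_lie_dim n Q"
        using large N_eq q two_mult_choose_two[of 7] by simp
    qed
  next
    case 7
    show ?case
    proof (intro impI conjI; elim conjE)
      assume "n = 6"
      then show "ereal (real (5 choose 2) + 6 + 5) \<le> nichols_lie_dim n Q"
        using small two_mult_choose_two[of 6] two_mult_choose_two[of 5] by simp
    next
      assume "n = 6" "\<forall>i\<in>{1..6}. Q i i = q" "q ^ 2 \<noteq> 1"
      then show "10 * N + 21 \<le> nichols_lie_dim n Q"
        using large N_eq q two_mult_choose_two[of 6] by simp
    qed
  next
    case 8
    have sum: "n = 4 \<Longrightarrow> (\<Sum>k=1..n. d k) = d 1 + d 2 + d 3 + d 4"
      by (simp add: eval_nat_numeral)
    show ?case
    proof (intro impI conjI; elim conjE)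
      assume hyp: "n = 4" "Q 3 3 = q" "Q 4 4 = q" "q ^ 4 = 1" "q ^ 2 \<noteq> 1"
      have "d 3 = 2" "d 4 = 2"
        using order[of 3] order[of 4] hyp q mult_order_eq_4[OF hyp(4,5)] by (simp_all add: diag_order_def)
      \<comment> \<open>The constant 14 exceeds n + (n choose 2) = 10 by 4, which is covered by the
        surplus d_3 + 2 d_4 = 6 of 3 (d_3 + d_4).\<close>
      then have "2 * d 3 + d 4 + 14 \<le> real n + real (n choose 2) + (real n - 1) * (\<Sum>k=1..n. d k)"
        using hyp(1) d0[of 1] d0[of 2] sum choose by simp
      from ge[OF this] show "2 * (N' 3 - 2) + (N' 4 - 2) + ereal (real (4 choose 2) + 4 + 4) \<le> nichols_lie_dim n Q"
        using hyp(1) two_mult_choose_two[of 4] by (simp add: N'_eq)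
    next
      assume hyp: "n = 4" "Q 1 1 = q ^ 2" "Q 2 2 = q ^ 2" "Q 3 3 = q" "Q 4 4 = q" "q ^ 4 \<noteq> 1"
      have "d k \<ge> 1" if "k \<in> {1..4}" for k
      proof -
        have "k = 1 \<or> k = 2 \<or> k = 3 \<or> k = 4"
          using that by auto
        then show ?thesis
          using hyp d1[of k] q4 that by auto
      qed
      then have "(\<Sum>k=1..3. d k) + (\<Sum>k=2..4. d k) + 16
          \<le> real n + real (n choose 2) + (real n - 1) * (\<Sum>k=1..n. d k)"
        using sum_ends_le[of 4 d] hyp(1) choose by simp
      from ge[OF this] show "(\<Sum>k=1..3. N' k - 2) + (\<Sum>k=2..4. N' k - 2) + ereal (3 * real (4 choose 2) - 2 * 3 + 4)
          \<le> nichols_lie_dim n Q"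
        using hyp(1) two_mult_choose_two[of 4] by (simp add: sumN')
    qed
  next
    case 9
    have sum: "n = 2 \<Longrightarrow> (\<Sum>k=1..n. d k) = d 1 + d 2"
      by (simp add: eval_nat_numeral)
    show ?case
    proof (intro impI conjI; elim conjE)
      assume "n = 2"
      then show "3 \<le> nichols_lie_dim n Q"
        using small by simp
    next
      assume "n = 2"
      \<comment> \<open>For n = 2 the factor n-1 is 1, and the uniform bound is the stated
        one.\<close>
      then show "(N' 1 - 2) + (N' 2 - 2) + 3 \<le> nichols_lie_dim n Q"
        using dim sum by (simp add: N'_eq algebra_simps)
    qed
  qed
qed

end
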